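(* Let $Z=[z_0:z_1:\cdots:z_n]$ be the homogeneous coordinate system of $\mathbb{C}\mathbb{P}^n$, and let $$\Lambda=\sum_{\alpha,\beta}\overleftarrow{\partial_{Z_\alpha}}\,\Lambda^{\alpha,\beta}\,\overrightarrow{\partial_{Z_\beta}}$$ define a holomorphic skew-symmetric biderivation of order zero acting on the structure sheaf $\mathcal{O}_{\mathbb{C}\mathbb{P}^n}$ and satisfying the Jacobi rule. Assume moreover that for every $k\ge1$ (summation over repeated indices) $$\bigl(\overleftarrow{\partial_{Z_{\alpha_1}}}\Lambda^{\alpha_1,\beta_1}\overrightarrow{\partial_{Z_{\beta_1}}}\bigr)\cdots\bigl(\overleftarrow{\partial_{Z_{\alpha_k}}}\Lambda^{\alpha_k,\beta_k}\overrightarrow{\partial_{Z_{\beta_k}}}\bigr)=\overleftarrow{\partial_{Z_{\alpha_1\ldots\alpha_k}}}\,\Lambda^{\alpha_1,\beta_1}\cdots\Lambda^{\alpha_k,\beta_k}\,\overrightarrow{\partial_{Z_{\beta_1\ldots\beta_k}}}.$$ Let $\#$ be the product $$f(Z)\# g(Z):=\sum_{k=0}^\infty\frac{1}{k!}\Bigl(\frac{\mu}{2}\Bigr)^k\Lambda^{\alpha_1\beta_1}\cdots\Lambda^{\alpha_k\beta_k}\,\partial_{Z_{\alpha_1}}\cdots\partial_{Z_{\alpha_k}}f(Z)\;\partial_{Z_{\beta_1}}\cdots\partial_{Z_{\beta_k}}g(Z).$$ Let $A[Z]:=ZA\,{}^tZ$ be a quadratic form, homogeneous of degree $2$, where $A$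 is a complex symmetric matrix. Then $$e_{\#}^{\frac1\mu A[Z]}=\det{}^{-1/2}\Bigl(\frac{e^{\Lambda A}+e^{-\Lambda A}}{2}\Bigr)\cdot e^{\frac1\mu\left(\frac{\Lambda^{-1}}{\sqrt{-1}}\tan(\sqrt{-1}\Lambda A)\right)[Z]}\in\sum_{k=0}^\infty H^0(\mathbb{C}\mathbb{P}^n,\mathcal{O}_{\mathbb{C}\mathbb{P}^n}(k)[\mu,\mu^{-1}]]).$$
   Context: Indices $\alpha,\beta,\alpha_i,\beta_i$ run over $0,\dots,n$; $Z_\alpha=z_\alpha$; repeated indices are summed (Einstein convention). $\mu$ is a formal parameter and $\#$ is extended bilinearly over the $\mu$-coefficients. Local sections of $\mathcal{O}_{\mathbb{C}\mathbb{P}^n}(k)$ are represented by holomorphic functions of $Z$ homogeneous of degree $k$; $H^0(\mathbb{C}\mathbb{P}^n,\mathcal{O}_{\mathbb{C}\mathbb{P}^n}(k))$ is identified with the space $\mathbb{C}[Z]_k$ of homogeneous polynomials of degree $k$. The biderivation $\Lambda$ acts by $f\,\Lambda\,g=\Lambda^{\alpha,\beta}(Z)\,\partial_{Z_\alpha}f\,\partial_{Z_\beta}g$, with holomorphic coefficients $\Lambda^{\alpha,\beta}=-\Lambda^{\beta,\alpha}$. "Of order zero" means that it preserves degrees of homogeneity (the coefficients $\Lambda^{\alpha,\beta}$ are homogeneous of degree $2$ in $Z$). The Jacobi rule means that $\{f,g\}:=f\Lambda g$ satisfies the Jacobi identity. Arrow notation: $f\,\overleftarrow{\partial_{Z_{\alpha_1\ldots\alpha_k}}}$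 means $\partial_{Z_{\alpha_1}}\cdots\partial_{Z_{\alpha_k}}f$, and $\overrightarrow{\partial_{Z_{\beta_1\ldots\beta_k}}}\,g$ means $\partial_{Z_{\beta_1}}\cdots\partial_{Z_{\beta_k}}g$. In the left-hand side of the displayed assumption, the factors are written one after another between $f$ (on the far left) and $g$ (on the far right), and each left (right) arrow differentiates everything standing to its left (right), including the coefficients of the other factors. The assumption is an equality of bidifferential operators in $Z$. In the formula, $Z$ is the row vector $(z_0,\dots,z_n)$, $\Lambda$ also denotes the matrix $(\Lambda^{\alpha,\beta})$, and $M[Z]:=ZM\,{}^tZ$ for a matrix $M$. The star exponential $e_\#^{\frac1\mu A[Z]}$ is the value at $t=1$ of the solution $F(t)$ of $\partial_tF=\frac1\mu A[Z]\#F$, $F(0)=1$, that is, $\sum_{m\ge0}\frac1{m!}\bigl(\frac1\mu A[Z]\bigr)^{\#m}$. Since $\#$ preserves the total degree of homogeneity in $Z$, this is a formal sum of its homogeneous components. The sum $\sum_{k=0}^\infty$ is understood as a formal (possibly infinite) sum of homogeneous components, and both sides are compared degree by degree in $Z$. $[\mu,\mu^{-1}]]$ denotes formal Laurent series in $\mu$ with finitely many negative powers (applied to each homogeneous component). The matrix functions are formal power series in $\Lambda A$; in particular $\frac{\Lambda^{-1}}{\sqrt{-1}}\tan(\sqrt{-1}\Lambda A)$ is the series obtained by cancelling the leading factor $\Lambda$ in $\frac{1}{\sqrt{-1}}\tan(\sqrt{-1}\Lambda A)=\Lambda A+\cdots$, so that it makes sense also when $\Lambda$ is not invertible. The branch of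 $\det^{-1/2}$ is the one with value $1$ at $A=0$. *)

theory Defs
  imports
    "HOL-Analysis.Determinants"
    "HOL-Library.Poly_Mapping"
    "HOL-Library.Groups_Big_Fun"
    "HOL-Computational_Algebra.Formal_Laurent_Series"
begin

unbundle no fps_syntax

text \<open>
  A finite type \<open>'i\<close> with \<open>CARD('i) = n + 1\<close> indexes the homogeneous coordinates
  \<open>z_0, \<dots>, z_n\<close>.  Polynomials in \<open>Z\<close> are finitely supported maps from exponent vectors to
  coefficients, with the convolution product of \<^theory>\<open>HOL-Library.Poly_Mapping\<close>.
\<close>

type_synonym ('i, 'a) mpoly = "('i \<Rightarrow>\<^sub>0 nat) \<Rightarrow>\<^sub>0 'a"

definition Var :: "'i \<Rightarrow> ('i, 'a::zero_neq_one) mpoly" where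
  "Var i = Poly_Mapping.single (Poly_Mapping.single i 1) 1"

definition Const :: "'a::zero \<Rightarrow> ('i, 'a) mpoly" where
  "Const c = Poly_Mapping.single 0 c"

definition mdeg :: "('i::finite \<Rightarrow>\<^sub>0 nat) \<Rightarrow> nat" where
  "mdeg m = (\<Sum>i\<in>UNIV. Poly_Mapping.lookup m i)"

definition hom_part :: "nat \<Rightarrow> ('i::finite, 'a::comm_monoid_add) mpoly \<Rightarrow> ('i, 'a) mpoly" where
  "hom_part d p = (\<Sum>m | m \<in> Poly_Mapping.keys p \<and> mdeg m = d.
     Poly_Mapping.single m (Poly_Mapping.lookup p m))"

text \<open>
  Global sections of \<open>\<O>(k)\<close> are identified with homogeneous polynomials of degree \<open>k\<close>.
  With \<open>'a = complex\<close> this is \<open>H^0(\<O>(k))\<close>; with \<open>'a = complex fls\<close>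
  (Laurent series in \<open>\<mu> = fls_X\<close> with finitely many negative powers) it is
  \<open>H^0(\<O>(k)[\<mu>,\<mu>^{-1}]])\<close>.
\<close>

definition H0 :: "nat \<Rightarrow> ('i::finite, 'a::zero) mpoly set" where
  "H0 k = {p. \<forall>m \<in> Poly_Mapping.keys p. mdeg m = k}"

definition dZ :: "'i \<Rightarrow> ('i, 'a::comm_semiring_1) mpoly \<Rightarrow> ('i, 'a) mpoly" where
  "dZ i p = (\<Sum>m \<in> Poly_Mapping.keys p.
     Poly_Mapping.single (m - Poly_Mapping.single i 1)
       (of_nat (Poly_Mapping.lookup m i) * Poly_Mapping.lookup p m))"

definition dZs :: "'i list \<Rightarrow> ('i, 'a::comm_semiring_1) mpoly \<Rightarrow> ('i, 'a) mpoly" where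
  "dZs as p = foldr dZ as p"

definition bracket ::
  "('i::finite, 'a::comm_ring_1) mpoly^'i^'i \<Rightarrow> ('i, 'a) mpoly \<Rightarrow> ('i, 'a) mpoly \<Rightarrow> ('i, 'a) mpoly" where
  "bracket L f g = (\<Sum>\<alpha>\<in>UNIV. \<Sum>\<beta>\<in>UNIV. L $ \<alpha> $ \<beta> * dZ \<alpha> f * dZ \<beta> g)"

definition indices :: "nat \<Rightarrow> 'i list set" where
  "indices k = {as. length as = k}"

definition bidiff ::
  "('i::finite, 'a::comm_ring_1) mpoly^'i^'i \<Rightarrow> nat \<Rightarrow> ('i, 'a) mpoly \<Rightarrow> ('i, 'a) mpoly \<Rightarrow> ('i, 'a) mpoly" where
  "bidiff L k f g = (\<Sum>as\<in>indices k. \<Sum>bs\<in>indices k.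
     (\<Prod>j<k. L $ (as ! j) $ (bs ! j)) * dZs as f * dZs bs g)"

text \<open>
  The product of \<open>k\<close> factors (left arrow, coefficient, right arrow) written between \<open>f\<close> and \<open>g\<close>.
  The functions occurring in it, from left to right, are numbered by positions:
  \<open>f\<close> has position \<open>0\<close>, the coefficient of factor \<open>j < k\<close> (counted from \<open>0\<close>) has position
  \<open>j + 1\<close>, and \<open>g\<close> has position \<open>k + 1\<close>.  By the Leibniz rule the left arrow of factor \<open>j\<close>
  is distributed over the positions \<open>0, \<dots>, j\<close> and its right arrow over the positions
  \<open>j + 2, \<dots>, k + 1\<close>; \<open>s j\<close> and \<open>t j\<close> are the positions chosen by the two arrows.
\<close>

definition arrow_product ::
  "('i::finite, 'a::comm_ring_1) mpoly^'i^'i \<Rightarrow> nat \<Rightarrow> ('i, 'a) mpoly \<Rightarrow> ('i, 'a) mpoly \<Rightarrow> ('i, 'a) mpoly" where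
  "arrow_product L k f g =
     (\<Sum>as\<in>indices k. \<Sum>bs\<in>indices k.
       \<Sum>s \<in> (\<Pi>\<^sub>E j\<in>{..<k}. {0..j}). \<Sum>t \<in> (\<Pi>\<^sub>E j\<in>{..<k}. {j+2..k+1}).
         dZs [as ! j. j \<leftarrow> [0..<k], s j = 0] f *
         (\<Prod>l<k. dZs ([as ! j. j \<leftarrow> [0..<k], s j = l + 1] @ [bs ! j. j \<leftarrow> [0..<k], t j = l + 1])
                   (L $ (as ! l) $ (bs ! l))) *
         dZs [bs ! j. j \<leftarrow> [0..<k], t j = k + 1] g)"

text \<open>
  Formal sums of homogeneous components: the component of degree \<open>d\<close> is the coefficient of
  \<open>X^d\<close>, so \<open>X\<close> only records the degree in \<open>Z\<close>.
\<close>

type_synonym 'i graded = "('i, complex fls) mpoly fps"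

definition formal_sections :: "'i::finite graded set" where
  "formal_sections = {F. \<forall>k. fps_nth F k \<in> H0 k}"

definition scalar :: "complex fls \<Rightarrow> 'i graded" where
  "scalar c = fps_const (Const c)"

definition mu_poly :: "('i, complex) mpoly \<Rightarrow> ('i, complex fls) mpoly" where
  "mu_poly p = Poly_Mapping.map fls_const p"

definition to_graded :: "('i::finite, complex) mpoly \<Rightarrow> 'i graded" where
  "to_graded p = Abs_fps (\<lambda>d. hom_part d (mu_poly p))"

definition quad_form :: "'i::finite graded^'i^'i \<Rightarrow> 'i graded" where
  "quad_form M = (\<Sum>\<alpha>\<in>UNIV. \<Sum>\<beta>\<in>UNIV. to_graded (Var \<alpha>) * M $ \<alpha> $ \<beta> * to_graded (Var \<beta>))"

text \<open>
  On polynomials the sum over \<open>k\<close> has only finitely many nonzero terms.  If the entries of \<open>L\<close>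
  are homogeneous of degree 2 then \<open>star_poly L\<close> maps degrees \<open>(i, j)\<close> to degree \<open>i + j\<close>,
  which is what the extension to formal sums relies on.
\<close>

definition star_poly ::
  "('i::finite, complex) mpoly^'i^'i \<Rightarrow> ('i, complex fls) mpoly \<Rightarrow> ('i, complex fls) mpoly \<Rightarrow> ('i, complex fls) mpoly" where
  "star_poly L f g =
     Sum_any (\<lambda>k. Const (fls_const (1 / fact k) * (fls_X * fls_const (1/2)) ^ k)
                   * bidiff (\<chi> \<alpha> \<beta>. mu_poly (L $ \<alpha> $ \<beta>)) k f g)"

definition star :: "('i::finite, complex) mpoly^'i^'i \<Rightarrow> 'i graded \<Rightarrow> 'i graded \<Rightarrow> 'i graded" where
  "star L F G = Abs_fps (\<lambda>d. \<Sum>i\<le>d. star_poly L (fps_nth F i) (fps_nth G (d - i)))"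

primrec star_power :: "('i::finite, complex) mpoly^'i^'i \<Rightarrow> 'i graded \<Rightarrow> nat \<Rightarrow> 'i graded" where
  "star_power L F 0 = 1"
| "star_power L F (Suc m) = star L F (star_power L F m)"

text \<open>
  The sum over \<open>m\<close> is taken degree by degree; it has finite support in each degree when
  \<open>F\<close> has no component of degree 0.
\<close>

definition star_exp :: "('i::finite, complex) mpoly^'i^'i \<Rightarrow> 'i graded \<Rightarrow> 'i graded" where
  "star_exp L F = Abs_fps (\<lambda>d.
     Sum_any (\<lambda>m. Const (fls_const (1 / fact m)) * fps_nth (star_power L F m) d))"

text \<open>
  Substitution of an element (or matrix) without component of degree 0 into a complex power series.
  As in \<^const>\<open>fps_compose\<close>, the powers \<open>k > d\<close> do not contribute in degree \<open>d\<close>.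
\<close>

definition subst_series :: "complex fps \<Rightarrow> 'i::finite graded \<Rightarrow> 'i graded" where
  "subst_series c x = fps_compose (Abs_fps (\<lambda>k. Const (fls_const (fps_nth c k)))) x"

primrec mat_power :: "'a::semiring_1^'i^'i \<Rightarrow> nat \<Rightarrow> 'a^'i^'i" where
  "mat_power M 0 = mat 1"
| "mat_power M (Suc k) = M ** mat_power M k"

definition mat_series :: "complex fps \<Rightarrow> 'i::finite graded^'i^'i \<Rightarrow> 'i graded^'i^'i" where
  "mat_series c M = (\<chi> i j. Abs_fps (\<lambda>d.
     \<Sum>k\<le>d. Const (fls_const (fps_nth c k)) * fps_nth (mat_power M k $ i $ j) d))"

definition mat_exp :: "'i::finite graded^'i^'i \<Rightarrow> 'i graded^'i^'i" where
  "mat_exp M = mat_series (fps_exp 1) M"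

text \<open>The branch of \<open>D^{-1/2}\<close> for \<open>D = 1 + \<dots>\<close> given by the binomial series.\<close>

definition inv_sqrt :: "'i::finite graded \<Rightarrow> 'i graded" where
  "inv_sqrt D = subst_series (fps_binomial (-1/2)) (D - 1)"

definition Lambda_mat :: "('i::finite, complex) mpoly^'i^'i \<Rightarrow> 'i graded^'i^'i" where
  "Lambda_mat L = (\<chi> \<alpha> \<beta>. to_graded (L $ \<alpha> $ \<beta>))"

definition const_mat :: "complex^'i^'i \<Rightarrow> 'i::finite graded^'i^'i" where
  "const_mat A = (\<chi> \<alpha> \<beta>. scalar (fls_const (A $ \<alpha> $ \<beta>)))"

definition tan_series :: "complex fps" where
  "tan_series = fps_const (1 / \<i>) * fps_tan \<i>"

text \<open>
  The series \<open>\<Lambda>\<inverse> (1/\<i>) tan (\<i> \<Lambda> A)\<close>: in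
  \<open>(1/\<i>) tan (\<i> \<Lambda> A) = \<Sum>k\<ge>1. c_k (\<Lambda> A)^k\<close> each power is written as
  \<open>\<Lambda> A (\<Lambda> A)^{k-1}\<close> and the leading \<open>\<Lambda>\<close> is dropped; see the lemma below.
\<close>

definition Lambda_inv_tan :: "'i::finite graded^'i^'i \<Rightarrow> 'i graded^'i^'i \<Rightarrow> 'i graded^'i^'i" where
  "Lambda_inv_tan L A = A ** mat_series (fps_shift 1 tan_series) (L ** A)"

lemma mat_power_nth_eq_0:
  fixes M :: "'i::finite graded^'i^'i"
  assumes M0: "\<And>i j. fps_nth (M $ i $ j) 0 = 0" and "d < m"
  shows "fps_nth (mat_power M m $ i $ j) d = 0"
  using \<open>d < m\<close>
proof (induction m arbitrary: d i)
  case (Suc m)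
  have "fps_nth (M $ i $ k) e * fps_nth (mat_power M m $ k $ j) (d - e) = 0" if "e \<le> d" for e k
  proof (cases "e = 0")
    case False
    then have "d - e < m" using Suc.prems that by auto
    then show ?thesis using Suc.IH by simp
  qed (simp add: M0)
  then show ?case
    by (simp add: matrix_matrix_mult_def fps_sum_nth fps_mult_nth)
qed simp

lemma mat_series_shift:
  fixes M :: "'i::finite graded^'i^'i"
  assumes M0: "\<And>i j. fps_nth (M $ i $ j) 0 = 0" and c0: "fps_nth c 0 = 0"
  shows "M ** mat_series (fps_shift 1 c) M = mat_series c M"
proof -
  let ?c = "\<lambda>k. Const (fls_const (fps_nth c k)) :: ('i, complex fls) mpoly"
  have "fps_nth ((M ** mat_series (fps_shift 1 c) M) $ i $ j) d = fps_nth (mat_series c M $ i $ j) d" for i j d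
  proof -
    have trunc: "fps_nth (M $ i $ k) e * (\<Sum>m\<le>d - e. ?c (Suc m) * fps_nth (mat_power M m $ k $ j) (d - e))
        = fps_nth (M $ i $ k) e * (\<Sum>m<d. ?c (Suc m) * fps_nth (mat_power M m $ k $ j) (d - e))"
      if "e \<le> d" for e k
    proof (cases "e = 0")
      case False
      have "(\<Sum>m<d. ?c (Suc m) * fps_nth (mat_power M m $ k $ j) (d - e))
          = (\<Sum>m\<le>d - e. ?c (Suc m) * fps_nth (mat_power M m $ k $ j) (d - e))"
        by (rule sum.mono_neutral_right) (use False that mat_power_nth_eq_0[OF M0] in auto)
      then show ?thesis by simp
    qed (simp add: M0)
    have "fps_nth ((M ** mat_series (fps_shift 1 c) M) $ i $ j) d
        = (\<Sum>k\<in>UNIV. \<Sum>e=0..d. fps_nth (M $ i $ k) e *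
             (\<Sum>m\<le>d - e. ?c (Suc m) * fps_nth (mat_power M m $ k $ j) (d - e)))"
      by (simp add: matrix_matrix_mult_def mat_series_def fps_sum_nth fps_mult_nth)
    also have "\<dots> = (\<Sum>k\<in>UNIV. \<Sum>e=0..d. \<Sum>m<d. fps_nth (M $ i $ k) e *
             (?c (Suc m) * fps_nth (mat_power M m $ k $ j) (d - e)))"
      by (intro sum.cong refl) (simp only: sum_distrib_left[symmetric] trunc atLeastAtMost_iff)
    also have "\<dots> = (\<Sum>k\<in>UNIV. \<Sum>m<d. \<Sum>e=0..d. fps_nth (M $ i $ k) e *
             (?c (Suc m) * fps_nth (mat_power M m $ k $ j) (d - e)))"
      by (rule sum.cong[OF refl]) (rule sum.swap)
    also have "\<dots> = (\<Sum>m<d. \<Sum>k\<in>UNIV. \<Sum>e=0..d. fps_nth (M $ i $ k) e *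
             (?c (Suc m) * fps_nth (mat_power M m $ k $ j) (d - e)))"
      by (rule sum.swap)
    also have "\<dots> = (\<Sum>m<d. ?c (Suc m) * fps_nth (mat_power M (Suc m) $ i $ j) d)"
      by (simp add: matrix_matrix_mult_def fps_sum_nth fps_mult_nth sum_distrib_left mult.left_commute)
    also have "\<dots> = (\<Sum>m\<in>{1..d}. ?c m * fps_nth (mat_power M m $ i $ j) d)"
      by (rule sum.reindex_bij_witness[of _ "\<lambda>m. m - 1" Suc]) auto
    also have "\<dots> = (\<Sum>m\<le>d. ?c m * fps_nth (mat_power M m $ i $ j) d)"
      by (rule sum.mono_neutral_left) (auto simp: c0 Const_def not_le)
    finally show ?thesis by (simp add: mat_series_def)
  qed
  then show ?thesis by (simp add: vec_eq_iff fps_eq_iff)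
qed

lemma Lambda_inv_tan:
  fixes L A :: "'i::finite graded^'i^'i"
  assumes "\<And>i j. fps_nth (L $ i $ j) 0 = 0"
  shows "L ** Lambda_inv_tan L A = mat_series tan_series (L ** A)"
proof -
  have "fps_nth ((L ** A) $ i $ j) 0 = 0" for i j
    using assms by (simp add: matrix_matrix_mult_def fps_sum_nth)
  moreover have "fps_nth tan_series 0 = 0"
    by (simp add: tan_series_def fps_tan_def fps_divide_unit fps_sin_def)
  ultimately show ?thesis
    unfolding Lambda_inv_tan_def matrix_mul_assoc by (rule mat_series_shift)
qed

end

theory Submission
  imports Defs
begin

text \<open>
  For \<open>k = 2\<close> the assumption on arrows says that \<open>{z_\<alpha>, \<Lambda>^{\<beta>\<gamma>}}\<close> is totally antisymmetric, so by the
  Jacobi rule it vanishes: the entries of \<open>\<Lambda>\<close> are Casimir functions.  The derivations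
  \<open>Y_\<alpha> = \<Lambda>^{\<alpha>\<beta>} \<partial>_\<beta>\<close> therefore treat \<open>\<Lambda>\<close> as a constant matrix, and \<open>F = A[Z]/\<mu>\<close> satisfies
  \<open>F # G = F G + (A Z)_\<alpha> Y_\<alpha> G + (\<mu>/4) A^{\<alpha>\<beta>} Y_\<alpha> Y_\<beta> G\<close>.
  Replacing \<open>A\<close> by \<open>t A\<close> multiplies the component of degree \<open>2m\<close> of either side of the theorem by \<open>t^m\<close>,
  so the equation \<open>\<partial>_t G = F # G\<close> becomes \<open>E G = 2 F # G\<close> for the Euler operator \<open>E\<close>, which
  multiplies the component of degree \<open>d\<close> by \<open>d\<close>.  With \<open>H = tanh (\<Lambda> A)\<close> and \<open>Q[Z]\<close> the exponent on
  the right-hand side times \<open>\<mu>\<close>, one has \<open>Y_\<alpha> (Q[Z]) = 2 (H Z)_\<alpha>\<close>, \<open>E (Q[Z]) = 2 (A - A H^2)[Z]\<close> and, by the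
  formula for the derivative of a determinant, that \<open>E\<close> multiplies \<open>det^{-1/2} cosh (\<Lambda> A)\<close> by
  \<open>- tr (\<Lambda> A H)\<close>; the equation follows.
\<close>

unbundle no Formal_Power_Series.fps_syntax

section \<open>Derivations of polynomial rings and Casimir functions\<close>

text \<open>One notion covers \<open>dZ\<close>, \<open>ham\<close>, \<open>euler\<close> and
  \<open>Y\<close>, which act on different rings. Constancy on scalars is stated separately wherever
  the coefficients of a series are involved.\<close>

definition derivation :: "('a::comm_ring_1 \<Rightarrow> 'a) \<Rightarrow> bool" where
  "derivation \<delta> \<longleftrightarrow> (\<forall>x y. \<delta> (x + y) = \<delta> x + \<delta> y) \<and> (\<forall>x y. \<delta> (x * y) = \<delta> x * y + x * \<delta> y)"

lemma derivation_add: "derivation \<delta> \<Longrightarrow> \<delta> (x + y) = \<delta> x + \<delta> y"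
  and derivation_mult: "derivation \<delta> \<Longrightarrow> \<delta> (x * y) = \<delta> x * y + x * \<delta> y"
  by (auto simp: derivation_def)

lemma derivation_0: "derivation \<delta> \<Longrightarrow> \<delta> 0 = 0"
  using derivation_add[of \<delta> 0 0] by simp

lemma derivation_1: "derivation \<delta> \<Longrightarrow> \<delta> 1 = 0"
  using derivation_mult[of \<delta> 1 1] by simp

lemma derivation_minus: "derivation \<delta> \<Longrightarrow> \<delta> (- x) = - \<delta> x"
  using derivation_add[of \<delta> x "- x"] by (simp add: derivation_0 eq_neg_iff_add_eq_0 add.commute)

lemma derivation_diff: "derivation \<delta> \<Longrightarrow> \<delta> (x - y) = \<delta> x - \<delta> y"
  using derivation_add[of \<delta> x "- y"] by (simp add: derivation_minus)

lemma derivation_sum: "derivation \<delta> \<Longrightarrow> \<delta> (sum f S) = (\<Sum>x\<in>S. \<delta> (f x))"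
  by (induction S rule: infinite_finite_induct) (auto simp: derivation_0 derivation_add)

lemma derivation_power: "derivation \<delta> \<Longrightarrow> \<delta> (x ^ Suc n) = of_nat (Suc n) * x ^ n * \<delta> x"
  by (induction n) (auto simp: derivation_mult algebra_simps)

text \<open>The replaced factor is marked by a conditional over all of \<open>S\<close>, so that the
  result can be read as a sum of determinants with one replaced row.\<close>

lemma derivation_prod:
  assumes "derivation \<delta>" "finite S"
  shows "\<delta> (\<Prod>x\<in>S. f x) = (\<Sum>x\<in>S. \<Prod>y\<in>S. if y = x then \<delta> (f y) else f y)"
  using assms(2)
proof (induction S rule: finite_induct)
  case (insert a S)
  have "(\<Prod>y\<in>insert a S. if y = a then \<delta> (f y) else f y) = \<delta> (f a) * (\<Prod>y\<in>S. f y)"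
  proof -
    have "(\<Prod>y\<in>S. if y = a then \<delta> (f y) else f y) = (\<Prod>y\<in>S. f y)"
      using insert by (intro prod.cong) auto
    then show ?thesis using insert by simp
  qed
  moreover have "(\<Prod>y\<in>insert a S. if y = x then \<delta> (f y) else f y)
      = f a * (\<Prod>y\<in>S. if y = x then \<delta> (f y) else f y)" if "x \<in> S" for x
    using insert that by (subst prod.insert) auto
  ultimately show ?case
    using insert by (simp add: derivation_mult[OF assms(1)] sum_distrib_left)
qed (simp add: derivation_1 assms(1))

lemma derivation_linear_combination:
  fixes \<delta> :: "'b \<Rightarrow> 'a::comm_ring_1 \<Rightarrow> 'a"
  assumes "\<And>b. derivation (\<delta> b)"
  shows "derivation (\<lambda>x. \<Sum>b\<in>S. c b * \<delta> b x)"
  using assms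
  by (simp add: derivation_def algebra_simps sum.distrib sum_distrib_left)

section \<open>Polynomials and their partial derivatives\<close>

lemma mpoly_eq_sum_single:
  "p = (\<Sum>m\<in>Poly_Mapping.keys p. Poly_Mapping.single m (Poly_Mapping.lookup p m))"
  by (rule poly_mapping_eqI) (simp add: lookup_sum lookup_single when_def in_keys_iff sum.delta)

lemma mpoly_induct [case_names single add]:
  fixes p :: "('i, 'a::comm_monoid_add) mpoly"
  assumes single: "\<And>m c. P (Poly_Mapping.single m c)" and add: "\<And>p q. P p \<Longrightarrow> P q \<Longrightarrow> P (p + q)"
  shows "P p"
proof -
  have "P (\<Sum>m\<in>S. Poly_Mapping.single m (Poly_Mapping.lookup p m))" if "finite S" for S
    using that
  proof (induction S rule: finite_induct)
    case empty
    then show ?case using single[of 0 0] by simp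
  qed (auto intro: single add)
  then show ?thesis by (metis finite_keys mpoly_eq_sum_single)
qed

text \<open>The truncated subtraction in \<open>dZ\<close> is harmless: if \<open>z_i\<close> does
  not occur in a monomial, the exponent vector is wrong but the factor \<open>of_nat 0\<close>
  removes the term. Otherwise adding the unit vector undoes the subtraction.\<close>

lemma lookup_dZ:
  fixes p :: "('i, 'a::comm_semiring_1) mpoly"
  shows "Poly_Mapping.lookup (dZ i p) m
     = of_nat (Suc (Poly_Mapping.lookup m i)) * Poly_Mapping.lookup p (m + Poly_Mapping.single i 1)"
proof -
  let ?e = "Poly_Mapping.single i 1 :: 'i \<Rightarrow>\<^sub>0 nat"
  have *: "Poly_Mapping.lookup (Poly_Mapping.single (m' - ?e)
       (of_nat (Poly_Mapping.lookup m' i) * Poly_Mapping.lookup p m')) m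
     = (if m' = m + ?e then of_nat (Suc (Poly_Mapping.lookup m i)) * Poly_Mapping.lookup p m' else 0)" for m'
  proof (cases "Poly_Mapping.lookup m' i = 0")
    case True
    then show ?thesis by (auto simp: lookup_add)
  next
    case False
    then have "m' - ?e + ?e = m'"
      by (intro poly_mapping_eqI) (auto simp: lookup_add lookup_minus lookup_single when_def)
    then have "m' - ?e = m \<longleftrightarrow> m' = m + ?e"
      by auto
    then show ?thesis
      by (auto simp: lookup_single lookup_add)
  qed
  show ?thesis
    unfolding dZ_def lookup_sum * by (simp add: sum.delta in_keys_iff)
qed

lemma dZ_add: "dZ i (p + q) = dZ i p + dZ i q"
  by (rule poly_mapping_eqI) (simp add: lookup_dZ lookup_add algebra_simps)

lemma dZ_single: "dZ i (Poly_Mapping.single m c)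
    = Poly_Mapping.single (m - Poly_Mapping.single i 1) (of_nat (Poly_Mapping.lookup m i) * c)"
  by (cases "c = 0") (auto simp: dZ_def)

text \<open>For two monomials the Leibniz rule is a comparison of exponents. Both sides are additive
  in each argument, so two inductions give the general case.\<close>

lemma derivation_dZ: "derivation (dZ i :: ('i, 'a::comm_ring_1) mpoly \<Rightarrow> _)"
proof -
  have single: "dZ i (Poly_Mapping.single m c * Poly_Mapping.single n d)
      = dZ i (Poly_Mapping.single m c) * Poly_Mapping.single n d
        + Poly_Mapping.single m c * dZ i (Poly_Mapping.single n d)" for m n and c d :: 'a
  proof -
    let ?e = "Poly_Mapping.single i 1 :: 'i \<Rightarrow>\<^sub>0 nat"
    have "m - ?e + n = m + n - ?e" if "Poly_Mapping.lookup m i \<noteq> 0" for m n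
      using that by (auto simp: poly_mapping_eq_iff fun_eq_iff lookup_add lookup_minus lookup_single when_def)
    \<comment> \<open>If \<open>z_i\<close> does not occur in \<open>m\<close>, the two exponents
      may differ, but both coefficients are zero.\<close>
    then have *: "Poly_Mapping.single (m - ?e + n) (of_nat (Poly_Mapping.lookup m i) * x)
        = Poly_Mapping.single (m + n - ?e) (of_nat (Poly_Mapping.lookup m i) * x)" for m n and x :: 'a
      by (cases "Poly_Mapping.lookup m i = 0") auto
    show ?thesis
      using *[of m n "c * d"] *[of n m "c * d"]
      by (simp add: dZ_single mult_single lookup_add algebra_simps flip: single_add)
  qed
  have "dZ i (p * Poly_Mapping.single n d) = dZ i p * Poly_Mapping.single n d + p * dZ i (Poly_Mapping.single n d)"
    for p n and d :: 'a
    by (induction p rule: mpoly_induct) (auto simp: single dZ_add algebra_simps)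
  then have "dZ i (p * q) = dZ i p * q + p * dZ i q" for p q :: "('i, 'a) mpoly"
    by (induction q rule: mpoly_induct) (auto simp: dZ_add algebra_simps)
  then show ?thesis by (simp add: derivation_def dZ_add)
qed

lemma dZ_Var: "dZ i (Var j :: ('i, 'a::comm_ring_1) mpoly) = (if i = j then 1 else 0)"
  by (auto simp: Var_def dZ_single lookup_single when_def)

lemma dZ_Const: "dZ i (Const c) = 0"
  by (auto simp: Const_def dZ_single)

lemmas dZ_simps = derivation_add[OF derivation_dZ] derivation_mult[OF derivation_dZ]
  derivation_0[OF derivation_dZ] derivation_1[OF derivation_dZ] derivation_minus[OF derivation_dZ]
  derivation_sum[OF derivation_dZ] dZ_Var dZ_Const

lemma dZ_dZ_Var: "dZ i (dZ j (Var k :: ('i, 'a::comm_ring_1) mpoly)) = 0"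
  by (cases "j = k") (simp_all add: dZ_simps)

text \<open>Derivatives of products of coordinates produce Kronecker deltas; this and the next two
  lemmas contract them in the shapes that occur.\<close>

lemma sum_mult_delta:
  fixes x :: "'i::finite \<Rightarrow> 'a::comm_semiring_1"
  shows "(\<Sum>i\<in>UNIV. x i * (if i = j then 1 else 0)) = x j"
  by (simp add: if_distrib[of "\<lambda>y. _ * y"] sum.delta cong: if_cong)

lemma sum_mult_delta':
  fixes x :: "'i::finite \<Rightarrow> 'a::comm_semiring_1"
  shows "(\<Sum>i\<in>UNIV. x i * (z * (if i = j then 1 else 0))) = z * x j"
  using sum_mult_delta[of "\<lambda>i. z * x i" j] by (simp add: mult_ac)

lemma sum_mult_delta2:
  fixes x :: "'i::finite \<Rightarrow> 'i \<Rightarrow> 'a::comm_semiring_1"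
  shows "(\<Sum>i\<in>UNIV. \<Sum>k\<in>UNIV. x i k * ((if k = l then 1 else 0) * (if i = j then 1 else 0))) = x j l"
  by (simp only: mult.assoc[symmetric] sum_distrib_right[symmetric] sum_mult_delta)

section \<open>Bidifferential operators of order at most two\<close>

lemma indices_0: "indices 0 = {[]}"
  by (auto simp: indices_def)

lemma sum_indices_Suc:
  "(\<Sum>as\<in>indices (Suc k). h as) = (\<Sum>a\<in>(UNIV::'i::finite set). \<Sum>as\<in>indices k. h (a # as))"
proof -
  have "(\<Sum>a\<in>(UNIV::'i set). \<Sum>as\<in>indices k. h (a # as)) = (\<Sum>(a, as)\<in>UNIV \<times> indices k. h (a # as))"
    by (rule sum.cartesian_product)
  also have "\<dots> = (\<Sum>as\<in>indices (Suc k). h as)"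
    by (rule sum.reindex_bij_witness[of _ "\<lambda>as. (hd as, tl as)" "\<lambda>(a, as). a # as"])
       (auto simp: indices_def length_Suc_conv)
  finally show ?thesis by simp
qed

lemma bidiff_0: "bidiff L 0 f g = f * g"
  by (simp add: bidiff_def indices_0 dZs_def)

lemma bidiff_1: "bidiff L (Suc 0) f g = bracket L f g"
  by (simp add: bidiff_def bracket_def sum_indices_Suc indices_0 dZs_def)

lemma bidiff_2: "bidiff L 2 f g = (\<Sum>\<alpha>\<in>UNIV. \<Sum>\<alpha>'\<in>UNIV. \<Sum>\<beta>\<in>UNIV. \<Sum>\<beta>'\<in>UNIV.
    L $ \<alpha> $ \<beta> * L $ \<alpha>' $ \<beta>' * dZ \<alpha> (dZ \<alpha>' f) * dZ \<beta> (dZ \<beta>' g))"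
  by (simp add: bidiff_def sum_indices_Suc indices_0 dZs_def numeral_2_eq_2 prod.lessThan_Suc)

text \<open>Two arrows have a choice: the left arrow of the second factor meets \<open>f\<close> or
  the first coefficient, and the right arrow of the first factor meets \<open>g\<close> or the
  second coefficient. The four summands are the combinations.\<close>

lemma arrow_product_2: "arrow_product L 2 f g = (\<Sum>\<alpha>\<in>UNIV. \<Sum>\<alpha>'\<in>UNIV. \<Sum>\<beta>\<in>UNIV. \<Sum>\<beta>'\<in>UNIV.
      (dZ \<alpha> (dZ \<alpha>' f) * (L $ \<alpha> $ \<beta> * L $ \<alpha>' $ \<beta>') * dZ \<beta> (dZ \<beta>' g)
    + dZ \<alpha> (dZ \<alpha>' f) * (L $ \<alpha> $ \<beta> * dZ \<beta> (L $ \<alpha>' $ \<beta>')) * dZ \<beta>' g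
    + dZ \<alpha> f * (dZ \<alpha>' (L $ \<alpha> $ \<beta>) * L $ \<alpha>' $ \<beta>') * dZ \<beta> (dZ \<beta>' g)
    + dZ \<alpha> f * (dZ \<alpha>' (L $ \<alpha> $ \<beta>) * dZ \<beta> (L $ \<alpha>' $ \<beta>')) * dZ \<beta>' g))"
proof -
  \<comment> \<open>The default \<open>undefined\<close> away from 0 and 1 makes
    \<open>fn x y\<close> an element of the extensional function space.\<close>
  define fn :: "nat \<Rightarrow> nat \<Rightarrow> nat \<Rightarrow> nat" where "fn = (\<lambda>x y. (\<lambda>_. undefined)(0 := x, 1 := y))"
  have fn: "fn x y 0 = x" "fn x y (Suc 0) = y" for x y by (auto simp: fn_def)
  have less2: "{..<2} = {0, 1::nat}" by auto
  have PiE: "(\<Pi>\<^sub>E j\<in>{..<2}. S j) = (\<lambda>(x, y). fn x y) ` (S 0 \<times> S 1)" for S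
    by (auto simp: less2 PiE_insert_eq fn_def image_iff fun_upd_twist split: prod.splits) blast+
  have inj: "inj_on (\<lambda>(x, y). fn x y) S" for S
    by (rule inj_onI) (metis (mono_tags, lifting) case_prod_conv fn surj_pair)
  have S: "{0..0::nat} \<times> {0..1::nat} = {(0,0),(0,1)}" "{0+2..2+1::nat} \<times> {1+2..2+1::nat} = {(2,3),(3,3)}"
    by auto
  show ?thesis
    unfolding arrow_product_def PiE sum.reindex[OF inj] S o_def
    by (simp add: sum_indices_Suc indices_0 numeral_2_eq_2 fn prod.lessThan_Suc dZs_def sum.distrib)
qed

text \<open>This is the Hamiltonian derivation \<open>{z_\<alpha>, -}\<close> of a coordinate, as
  \<open>bracket_Var\<close> confirms.\<close>

definition ham :: "('i::finite, 'a::comm_ring_1) mpoly^'i^'i \<Rightarrow> 'i \<Rightarrow> ('i, 'a) mpoly \<Rightarrow> ('i, 'a) mpoly" where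
  "ham L \<alpha> p = (\<Sum>\<beta>\<in>UNIV. L $ \<alpha> $ \<beta> * dZ \<beta> p)"

lemma derivation_ham: "derivation (ham L \<alpha>)"
  unfolding ham_def by (intro derivation_linear_combination derivation_dZ)

lemma ham_Var: "ham L \<alpha> (Var \<beta>) = L $ \<alpha> $ \<beta>"
  by (simp add: ham_def dZ_Var if_distrib[of "\<lambda>x. _ * x"] sum.delta cong: if_cong)

lemma bracket_Var: "bracket L (Var \<alpha>) g = ham L \<alpha> g"
  by (simp add: bracket_def ham_def dZ_Var if_distrib[of "\<lambda>x. _ * x"] if_distrib[of "\<lambda>x. x * _"]
      sum.delta sum.swap[of _ UNIV UNIV] cong: if_cong)

text \<open>Second derivatives of a coordinate vanish, so only the choices survive in which the left
  arrow of the second factor hits the first coefficient.\<close>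

lemma arrow_product_2_Var:
  "arrow_product L 2 (Var a) g = (\<Sum>\<alpha>\<in>UNIV. \<Sum>\<beta>\<in>UNIV. \<Sum>\<beta>'\<in>UNIV.
      dZ \<alpha> (L $ a $ \<beta>) * L $ \<alpha> $ \<beta>' * dZ \<beta> (dZ \<beta>' g)
    + dZ \<alpha> (L $ a $ \<beta>) * dZ \<beta> (L $ \<alpha> $ \<beta>') * dZ \<beta>' g)"
proof -
  have "arrow_product L 2 (Var a) g = (\<Sum>\<alpha>'\<in>UNIV. if a = \<alpha>' then (\<Sum>\<alpha>\<in>UNIV. \<Sum>\<beta>\<in>UNIV. \<Sum>\<beta>'\<in>UNIV.
      dZ \<alpha> (L $ \<alpha>' $ \<beta>) * L $ \<alpha> $ \<beta>' * dZ \<beta> (dZ \<beta>' g)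
    + dZ \<alpha> (L $ \<alpha>' $ \<beta>) * dZ \<beta> (L $ \<alpha> $ \<beta>') * dZ \<beta>' g) else 0)"
    unfolding arrow_product_2 dZ_dZ_Var by (intro sum.cong refl) (auto simp: dZ_Var)
  then show ?thesis by (simp add: sum.delta)
qed

text \<open>
  Testing the assumption on \<open>z_\<alpha>\<close> and \<open>z_\<beta> z_\<gamma>\<close> shows that \<open>{z_\<beta>, \<Lambda>^{\<alpha>\<gamma>}}\<close> is antisymmetric in \<open>\<beta>, \<gamma>\<close>; the
  contribution in which all arrows but the outermost hit coefficients is removed by testing on
  \<open>z_\<alpha>\<close> and \<open>z_\<beta>\<close>.
\<close>

lemma ham_entry_eq_0:
  fixes L :: "('i::finite, complex) mpoly^'i^'i"
  assumes skew: "\<And>\<alpha> \<beta>. L $ \<alpha> $ \<beta> = - (L $ \<beta> $ \<alpha>)"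
    and jacobi: "\<And>f g h. bracket L f (bracket L g h) + bracket L g (bracket L h f)
                          + bracket L h (bracket L f g) = 0"
    and arrows: "\<And>f g. arrow_product L 2 f g = bidiff L 2 f g"
  shows "ham L \<alpha> (L $ \<beta> $ \<gamma>) = 0"
proof -
  \<comment> \<open>A coordinate has no second derivatives, hence the arrow product with a
    coordinate on the left must vanish as well.\<close>
  have bidiff: "bidiff L 2 (Var a) g = 0" for a g
    by (simp add: bidiff_2 dZ_dZ_Var)
  have quadratic: "(\<Sum>\<alpha>\<in>UNIV. \<Sum>\<beta>\<in>UNIV. dZ \<alpha> (L $ a $ \<beta>) * dZ \<beta> (L $ \<alpha> $ b)) = 0" for a b
  proof -
    have "arrow_product L 2 (Var a) (Var b) = (\<Sum>\<alpha>\<in>UNIV. \<Sum>\<beta>\<in>UNIV. dZ \<alpha> (L $ a $ \<beta>) * dZ \<beta> (L $ \<alpha> $ b))"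
      unfolding arrow_product_2_Var dZ_dZ_Var by (simp add: dZ_Var sum_mult_delta)
    then show ?thesis using arrows bidiff by metis
  qed
  have U1: "ham L b (L $ a $ c) = - ham L c (L $ a $ b)" for a b c
  proof -
    have "0 = arrow_product L 2 (Var a) (Var b * Var c)"
      using arrows bidiff by metis
    also have "\<dots> = (\<Sum>\<alpha>\<in>UNIV. \<Sum>\<beta>\<in>UNIV. dZ \<alpha> (L $ a $ \<beta>) * dZ \<beta> (L $ \<alpha> $ b)) * Var c
         + (\<Sum>\<alpha>\<in>UNIV. \<Sum>\<beta>\<in>UNIV. dZ \<alpha> (L $ a $ \<beta>) * dZ \<beta> (L $ \<alpha> $ c)) * Var b
         + ((\<Sum>\<alpha>\<in>UNIV. dZ \<alpha> (L $ a $ b) * L $ \<alpha> $ c) + (\<Sum>\<alpha>\<in>UNIV. dZ \<alpha> (L $ a $ c) * L $ \<alpha> $ b))"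
    proof -
      let ?d = "\<lambda>i j. if i = j then 1 else 0 :: ('i, complex) mpoly"
      have "dZ \<beta> (dZ \<beta>' (Var b * Var c)) = ?d \<beta>' b * ?d \<beta> c + ?d \<beta>' c * ?d \<beta> b" for \<beta> \<beta>'
        by (simp add: derivation_mult[OF derivation_dZ] derivation_add[OF derivation_dZ] dZ_dZ_Var) (simp add: dZ_Var)
      moreover have "dZ \<beta> (Var b * Var c) = Var c * ?d \<beta> b + Var b * ?d \<beta> c" for \<beta>
        by (simp add: derivation_mult[OF derivation_dZ] dZ_Var)
      ultimately show ?thesis
        by (simp only: arrow_product_2_Var distrib_left sum.distrib sum_mult_delta2 sum_mult_delta'
            sum_distrib_left[symmetric]) (simp add: algebra_simps)
    qed
    also have "\<dots> = - ham L c (L $ a $ b) - ham L b (L $ a $ c)"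
      by (simp add: quadratic ham_def skew[of c] skew[of b] sum_negf mult.commute)
    finally show ?thesis by (simp add: algebra_simps)
  qed
  have U2: "ham L a (L $ b $ c) = - ham L a (L $ c $ b)" for a b c
    by (subst skew) (rule derivation_minus[OF derivation_ham])
  \<comment> \<open>The two antisymmetries together give invariance under cyclic shifts of the three
    indices, so the Jacobi sum is three times a single term.\<close>
  have cyc: "ham L b (L $ c $ a) = ham L c (L $ a $ b)" for a b c
    using U1[of b a c] U2[of b a c] by simp
  have "ham L a (L $ b $ c) + ham L b (L $ c $ a) + ham L c (L $ a $ b) = 0" for a b c
    using jacobi[of "Var a" "Var b" "Var c"] by (simp add: bracket_Var ham_Var)
  from this[of \<alpha> \<beta> \<gamma>]
  have sum3: "ham L \<alpha> (L $ \<beta> $ \<gamma>) + ham L \<alpha> (L $ \<beta> $ \<gamma>) + ham L \<alpha> (L $ \<beta> $ \<gamma>) = 0"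
    using cyc[of \<gamma> \<alpha> \<beta>] cyc[of \<alpha> \<beta> \<gamma>] by simp
  show ?thesis
  \<comment> \<open>The factor three is cancelled on the complex coefficients.\<close>
  proof (rule poly_mapping_eqI)
    fix m
    show "Poly_Mapping.lookup (ham L \<alpha> (L $ \<beta> $ \<gamma>)) m = Poly_Mapping.lookup 0 m"
      using arg_cong[OF sum3, of "\<lambda>p. Poly_Mapping.lookup p m"] by (simp only: lookup_add lookup_zero) simp
  qed
qed

section \<open>Power series of matrices\<close>

text \<open>For an additive map this says that the coefficient of degree \<open>n\<close> of the
  image depends only on the coefficients of degree at most \<open>n\<close> of the argument.
  Derivations of infinite series can then be computed on partial sums.\<close>

definition causal :: "('a::zero fps \<Rightarrow> 'a fps) \<Rightarrow> bool" where
  "causal \<delta> \<longleftrightarrow> (\<forall>F n. (\<forall>d\<le>n. fps_nth F d = 0) \<longrightarrow> fps_nth (\<delta> F) n = 0)"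

definition map_coeffs :: "('a \<Rightarrow> 'b) \<Rightarrow> 'a fps \<Rightarrow> 'b fps" where
  "map_coeffs f F = Abs_fps (\<lambda>n. f (fps_nth F n))"

lemma map_coeffs_nth [simp]: "fps_nth (map_coeffs f F) n = f (fps_nth F n)"
  by (simp add: map_coeffs_def)

lemma derivation_map_coeffs:
  assumes "derivation \<delta>"
  shows "derivation (map_coeffs \<delta>)"
  by (simp add: derivation_def[of "map_coeffs \<delta>"] fps_eq_iff fps_mult_nth derivation_add[OF assms]
      derivation_mult[OF assms] derivation_sum[OF assms] sum.distrib)

lemma causal_map_coeffs: "derivation \<delta> \<Longrightarrow> causal (map_coeffs \<delta>)"
  by (simp add: causal_def derivation_0[of \<delta>])

definition euler :: "'a::comm_ring_1 fps \<Rightarrow> 'a fps" where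
  "euler F = fps_X * fps_deriv F"

lemma euler_nth: "fps_nth (euler F) n = of_nat n * fps_nth F n"
  by (cases n) (auto simp: euler_def)

lemma derivation_euler: "derivation euler"
  by (auto simp: derivation_def euler_def algebra_simps)

lemma causal_euler: "causal euler"
  by (simp add: causal_def euler_nth)

section \<open>Substitution into power series\<close>

lemma fps_mult_nth_cong:
  assumes "\<And>d. d \<le> n \<Longrightarrow> fps_nth F d = fps_nth G d"
  shows "fps_nth (F * H) n = fps_nth (G * H) n"
  using assms by (simp add: fps_mult_nth)

text \<open>The power \<open>x ^ i\<close> has no component below degree \<open>i\<close>. A bound
  common to all degrees up to \<open>n\<close> turns the composition into one polynomial in
  \<open>x\<close>.\<close>

lemma fps_compose_nth_approx:
  fixes c x :: "'a::comm_ring_1 fps"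
  assumes "fps_nth x 0 = 0" "d \<le> n"
  shows "fps_nth (fps_compose c x) d = fps_nth (\<Sum>i\<le>n. fps_const (fps_nth c i) * x ^ i) d"
proof -
  have "(\<Sum>i\<le>n. fps_nth c i * fps_nth (x ^ i) d) = (\<Sum>i\<in>{0..d}. fps_nth c i * fps_nth (x ^ i) d)"
    using assms by (intro sum.mono_neutral_right) (auto simp: startsby_zero_power_prefix)
  then show ?thesis by (simp add: fps_compose_nth fps_sum_nth)
qed

text \<open>On a polynomial in \<open>x\<close> the chain rule is the power rule; causality carries
  it over to the series, degree by degree.\<close>

lemma derivation_fps_compose:
  fixes \<delta> :: "'a::comm_ring_1 fps \<Rightarrow> 'a fps"
  assumes \<delta>: "derivation \<delta>" "causal \<delta>" and c: "\<And>i. \<delta> (fps_const (fps_nth c i)) = 0"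
    and x0: "fps_nth x 0 = 0"
  shows "\<delta> (fps_compose c x) = fps_compose (fps_deriv c) x * \<delta> x"
proof (rule fps_ext)
  fix n
  \<comment> \<open>Differentiation lowers the powers of \<open>x\<close> by one, so the sum runs to
    \<open>Suc n\<close> for the derivative to keep all powers up to \<open>n\<close>.\<close>
  define p where "p = (\<Sum>i\<le>Suc n. fps_const (fps_nth c i) * x ^ i)"
  have "\<forall>d\<le>n. fps_nth (fps_compose c x - p) d = 0"
    using fps_compose_nth_approx[OF x0, of _ "Suc n" c] by (simp add: p_def)
  then have "fps_nth (\<delta> (fps_compose c x - p)) n = 0"
    using \<delta>(2) unfolding causal_def by blast
  then have "fps_nth (\<delta> (fps_compose c x)) n = fps_nth (\<delta> p) n"
    by (simp add: derivation_diff[OF \<delta>(1)])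
  also have "\<delta> p = (\<Sum>i\<le>Suc n. fps_const (fps_nth c i) * \<delta> (x ^ i))"
    by (simp only: p_def derivation_sum[OF \<delta>(1)] derivation_mult[OF \<delta>(1)] c mult_zero_left add_0)
  also have "\<dots> = (\<Sum>i\<le>n. fps_const (fps_nth c (Suc i)) * \<delta> (x ^ Suc i))"
    by (subst sum.atMost_Suc_shift) (simp add: derivation_1[OF \<delta>(1)])
  also have "\<dots> = (\<Sum>i\<le>n. fps_const (fps_nth (fps_deriv c) i) * x ^ i) * \<delta> x"
    unfolding derivation_power[OF \<delta>(1)] sum_distrib_right
    by (intro sum.cong refl) (simp only: fps_deriv_nth Suc_eq_plus1 fps_const_mult[symmetric] fps_of_nat mult_ac)
  also have "fps_nth \<dots> n = fps_nth (fps_compose (fps_deriv c) x * \<delta> x) n"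
    by (intro fps_mult_nth_cong) (simp add: fps_compose_nth_approx[OF x0])
  finally show "fps_nth (\<delta> (fps_compose c x)) n = fps_nth (fps_compose (fps_deriv c) x * \<delta> x) n" .
qed

text \<open>This transports the equation \<open>(1 + X) f' = c f\<close> of the binomial series to
  the substituted series. The proof is an index shift in truncated sums.\<close>

lemma fps_compose_mult_1_plus_X:
  fixes c x :: "'a::comm_ring_1 fps"
  assumes x0: "fps_nth x 0 = 0"
  shows "fps_compose (c * (1 + fps_X)) x = fps_compose c x * (1 + x)"
proof -
  have "fps_nth (fps_compose (c * fps_X) x) n = fps_nth (fps_compose c x * x) n" for n
  proof -
    have "fps_nth (fps_compose (c * fps_X) x) n
        = fps_nth (\<Sum>i\<le>Suc n. fps_const (fps_nth (c * fps_X) i) * x ^ i) n"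
      by (rule fps_compose_nth_approx[OF x0]) simp
    also have "(\<Sum>i\<le>Suc n. fps_const (fps_nth (c * fps_X) i) * x ^ i)
        = (\<Sum>i\<le>n. fps_const (fps_nth c i) * x ^ i) * x"
      by (subst sum.atMost_Suc_shift) (simp add: sum_distrib_left mult_ac)
    also have "fps_nth \<dots> n = fps_nth (fps_compose c x * x) n"
      by (intro fps_mult_nth_cong) (simp add: fps_compose_nth_approx[OF x0])
    finally show ?thesis .
  qed
  then have "fps_compose (c * fps_X) x = fps_compose c x * x"
    by (rule fps_ext)
  then show ?thesis
    by (simp add: distrib_left fps_compose_add_distrib)
qed

text \<open>Jacobi's formula, with the derivative of \<open>M\<close> written as
  \<open>N ** M\<close> so that neither an inverse nor an adjugate of \<open>M\<close> enters. Row
  \<open>i\<close> of the derivative is a combination of the rows of \<open>M\<close>, and by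
  alternation only row \<open>i\<close> itself contributes.\<close>

lemma derivation_det:
  fixes M N :: "'a::comm_ring_1^'i^'i"
  assumes \<delta>: "derivation \<delta>" and M: "\<And>i j. \<delta> (M $ i $ j) = (N ** M) $ i $ j"
  shows "\<delta> (det M) = trace N * det M"
proof -
  have sign: "\<delta> (of_int (sign p)) = 0" for p :: "'i \<Rightarrow> 'i"
    by (simp add: sign_def derivation_minus[OF \<delta>] derivation_1[OF \<delta>])
  have row: "det (\<chi> k. if k = i then (N ** M) $ k else M $ k) = N $ i $ i * det M" for i
  proof -
    have "(N ** M) $ k = (\<Sum>j\<in>UNIV. N $ k $ j *s M $ j)" for k
      by (simp add: vec_eq_iff matrix_matrix_mult_def)
    then have "det (\<chi> k. if k = i then (N ** M) $ k else M $ k)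
        = (\<Sum>j\<in>UNIV. det (\<chi> k. if k = i then N $ k $ j *s M $ j else M $ k))"
      using det_linear_row_sum[of UNIV i "\<lambda>k j. N $ k $ j *s M $ j" "\<lambda>k. M $ k"] by (simp cong del: if_weak_cong)
    also have "\<dots> = (\<Sum>j\<in>UNIV. if j = i then N $ i $ i * det M else 0)"
    proof (rule sum.cong[OF refl])
      fix j
      have "det (\<chi> k. if k = i then N $ k $ j *s M $ j else M $ k)
          = det (\<chi> k. if k = i then N $ i $ j *s M $ j else M $ k)"
        by (rule arg_cong[of _ _ det]) (simp add: vec_eq_iff)
      also have "\<dots> = N $ i $ j * det (\<chi> k. if k = i then M $ j else M $ k)"
        by (rule det_row_mul)
      also have "det (\<chi> k. if k = i then M $ j else M $ k) = (if j = i then det M else 0)"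
      proof (cases "j = i")
        case True
        then have "(\<chi> k. if k = i then M $ j else M $ k) = M" by (simp add: vec_eq_iff)
        then show ?thesis using True by simp
      next
        case False
        then show ?thesis by (simp add: row_def vec_nth_inverse det_identical_rows[of i j])
      qed
      finally show "det (\<chi> k. if k = i then N $ k $ j *s M $ j else M $ k)
          = (if j = i then N $ i $ i * det M else 0)" by (auto split: if_splits)
    qed
    finally show ?thesis by (simp add: sum.delta)
  qed
  have "\<delta> (det M) = (\<Sum>p | p permutes UNIV. \<Sum>i\<in>UNIV. of_int (sign p) *
      (\<Prod>k\<in>UNIV. if k = i then \<delta> (M $ k $ p k) else M $ k $ p k))"
    by (simp add: det_def derivation_sum[OF \<delta>] derivation_mult[OF \<delta>] sign derivation_prod[OF \<delta>] sum_distrib_left)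
  also have "\<dots> = (\<Sum>i\<in>UNIV. \<Sum>p | p permutes UNIV. of_int (sign p) *
      (\<Prod>k\<in>UNIV. if k = i then \<delta> (M $ k $ p k) else M $ k $ p k))"
    by (rule sum.swap)
  also have "\<dots> = (\<Sum>i\<in>UNIV. det (\<chi> k. if k = i then (N ** M) $ k else M $ k))"
    unfolding det_def by (intro sum.cong refl arg_cong2[of _ _ _ _ "(*)"] prod.cong) (simp add: M)
  finally show ?thesis by (simp add: row trace_def sum_distrib_right)
qed

section \<open>Series in one matrix without component of degree zero\<close>

lemma Const_0 [simp]: "Const 0 = 0"
  and Const_1 [simp]: "Const 1 = 1"
  and Const_add: "Const (a + b) = Const a + Const b"
  and Const_mult: "Const (x * y) = Const x * Const y"
  for a b :: "'a::comm_monoid_add" and x y :: "'b::comm_semiring_1"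
  by (simp_all add: Const_def single_add mult_single)

lemma Const_of_nat: "Const (of_nat n) = of_nat n"
  by (induction n) (simp_all add: Const_add)

lemma mat_power_add: "mat_power M (m + n) = mat_power M m ** mat_power M n"
  by (induction m) (simp_all add: matrix_mul_assoc)

lemma mat_power_Suc': "mat_power M (Suc n) = mat_power M n ** M"
  using mat_power_add[of M n 1] by simp

lemma matrix_mult_fps_nth:
  "fps_nth ((M ** N) $ i $ j) d = (\<Sum>k\<in>UNIV. \<Sum>e=0..d. fps_nth (M $ i $ k) e * fps_nth (N $ k $ j) (d - e))"
  by (simp add: matrix_matrix_mult_def fps_sum_nth fps_mult_nth)

context
  fixes M :: "'i::finite graded^'i^'i"
  assumes M0: "\<And>i j. fps_nth (M $ i $ j) 0 = 0"
begin

text \<open>The summation bound in \<open>mat_series\<close> varies with the degree. Adding powers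
  that vanish in the degrees considered makes it uniform, so that sums over degrees and over powers
  can be exchanged.\<close>

lemma mat_series_nth_approx:
  assumes "d \<le> n"
  shows "fps_nth (mat_series c M $ i $ j) d
    = (\<Sum>k\<le>n. Const (fls_const (fps_nth c k)) * fps_nth (mat_power M k $ i $ j) d)"
proof -
  have "(\<Sum>k\<le>n. Const (fls_const (fps_nth c k)) * fps_nth (mat_power M k $ i $ j) d)
      = (\<Sum>k\<le>d. Const (fls_const (fps_nth c k)) * fps_nth (mat_power M k $ i $ j) d)"
    by (intro sum.mono_neutral_right) (use assms mat_power_nth_eq_0[OF M0] in auto)
  then show ?thesis by (simp add: mat_series_def)
qed

lemma mult_mat_series_nth:
  "fps_nth ((N ** mat_series c M) $ i $ j) d
    = (\<Sum>k\<le>d. Const (fls_const (fps_nth c k)) * fps_nth ((N ** mat_power M k) $ i $ j) d)"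
proof -
  have "fps_nth ((N ** mat_series c M) $ i $ j) d
      = (\<Sum>l\<in>UNIV. \<Sum>e=0..d. \<Sum>k\<le>d. Const (fls_const (fps_nth c k)) *
          (fps_nth (N $ i $ l) e * fps_nth (mat_power M k $ l $ j) (d - e)))"
    by (simp add: matrix_mult_fps_nth mat_series_nth_approx[of _ d] sum_distrib_left mult.left_commute)
  also have "\<dots> = (\<Sum>l\<in>UNIV. \<Sum>k\<le>d. \<Sum>e=0..d. Const (fls_const (fps_nth c k)) *
          (fps_nth (N $ i $ l) e * fps_nth (mat_power M k $ l $ j) (d - e)))"
    by (rule sum.cong[OF refl]) (rule sum.swap)
  also have "\<dots> = (\<Sum>k\<le>d. \<Sum>l\<in>UNIV. \<Sum>e=0..d. Const (fls_const (fps_nth c k)) *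
          (fps_nth (N $ i $ l) e * fps_nth (mat_power M k $ l $ j) (d - e)))"
    by (rule sum.swap)
  finally show ?thesis by (simp add: matrix_mult_fps_nth sum_distrib_left)
qed

lemma mat_series_mult_nth:
  "fps_nth ((mat_series c M ** N) $ i $ j) d
    = (\<Sum>k\<le>d. Const (fls_const (fps_nth c k)) * fps_nth ((mat_power M k ** N) $ i $ j) d)"
proof -
  have "fps_nth ((mat_series c M ** N) $ i $ j) d
      = (\<Sum>l\<in>UNIV. \<Sum>e=0..d. \<Sum>k\<le>d. Const (fls_const (fps_nth c k)) *
          (fps_nth (mat_power M k $ i $ l) e * fps_nth (N $ l $ j) (d - e)))"
    by (simp add: matrix_mult_fps_nth mat_series_nth_approx[of _ d] sum_distrib_right mult.assoc)
  also have "\<dots> = (\<Sum>l\<in>UNIV. \<Sum>k\<le>d. \<Sum>e=0..d. Const (fls_const (fps_nth c k)) *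
          (fps_nth (mat_power M k $ i $ l) e * fps_nth (N $ l $ j) (d - e)))"
    by (rule sum.cong[OF refl]) (rule sum.swap)
  also have "\<dots> = (\<Sum>k\<le>d. \<Sum>l\<in>UNIV. \<Sum>e=0..d. Const (fls_const (fps_nth c k)) *
          (fps_nth (mat_power M k $ i $ l) e * fps_nth (N $ l $ j) (d - e)))"
    by (rule sum.swap)
  finally show ?thesis by (simp add: matrix_mult_fps_nth sum_distrib_left)
qed

lemma mat_series_mult: "mat_series a M ** mat_series b M = mat_series (a * b) M"
proof -
  have "fps_nth ((mat_series a M ** mat_series b M) $ i $ j) d = fps_nth (mat_series (a * b) M $ i $ j) d" for i j d
  proof -
    let ?t = "\<lambda>m n. Const (fls_const (fps_nth a m * fps_nth b n)) * fps_nth (mat_power M (m + n) $ i $ j) d"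
    have "fps_nth ((mat_series a M ** mat_series b M) $ i $ j) d
        = (\<Sum>m\<le>d. \<Sum>n\<le>d. ?t m n)"
      by (subst mat_series_mult_nth)
         (simp add: mult_mat_series_nth sum_distrib_left mat_power_add mult.assoc Const_mult
           flip: fls_const_mult_const)
    also have "\<dots> = (\<Sum>(m, n)\<in>{..d} \<times> {..d}. ?t m n)"
      by (rule sum.cartesian_product)
    \<comment> \<open>The square shrinks to a triangle because powers of \<open>M\<close> with
      exponent above \<open>d\<close> have no component of degree \<open>d\<close>.\<close>
    also have "\<dots> = (\<Sum>(m, n)\<in>{(m, n). m + n \<le> d}. ?t m n)"
    proof (intro sum.mono_neutral_right ballI)
      fix p assume "p \<in> {..d} \<times> {..d} - {(m, n). m + n \<le> d}"
      then obtain m n where "p = (m, n)" "d < m + n" by (cases p) auto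
      then show "(case p of (m, n) \<Rightarrow> ?t m n) = 0" by (simp add: mat_power_nth_eq_0[OF M0])
    qed auto
    also have "\<dots> = (\<Sum>k\<le>d. \<Sum>m\<le>k. ?t m (k - m))"
      by (rule sum.triangle_reindex_eq)
    also have "\<dots> = (\<Sum>k\<le>d. Const (fls_const (fps_nth (a * b) k)) * fps_nth (mat_power M k $ i $ j) d)"
    proof (intro sum.cong refl)
      fix k
      have "Const (fls_const (fps_nth (a * b) k))
          = (\<Sum>m\<le>k. Const (fls_const (fps_nth a m * fps_nth b (k - m))) :: ('i, complex fls) mpoly)"
      proof -
        have "Const (fls_const (sum f S)) = (\<Sum>m\<in>S. Const (fls_const (f m)) :: ('i, complex fls) mpoly)"
          if "finite S" for f and S :: "nat set"
          using that by (induction S rule: finite_induct) (simp_all add: Const_add flip: fls_plus_const)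
        then show ?thesis by (simp add: fps_mult_nth atLeast0AtMost)
      qed
      then show "(\<Sum>m\<le>k. ?t m (k - m)) = Const (fls_const (fps_nth (a * b) k)) * fps_nth (mat_power M k $ i $ j) d"
        by (simp add: sum_distrib_right)
    qed
    finally show ?thesis by (simp add: mat_series_def)
  qed
  then show ?thesis by (simp add: vec_eq_iff fps_eq_iff)
qed

end


section \<open>Scalars, signs and derivations of matrix series\<close>

lemma derivation_mult_left: "derivation \<delta> \<Longrightarrow> derivation (\<lambda>x. a * \<delta> x)"
  by (simp add: derivation_def algebra_simps)

lemma causal_mult_left: "causal \<delta> \<Longrightarrow> causal (\<lambda>F. G * \<delta> F :: 'a::comm_ring_1 fps)"
  unfolding causal_def fps_mult_nth by (auto intro!: sum.neutral)

lemma scalar_0 [simp]: "scalar 0 = 0" and scalar_1 [simp]: "scalar 1 = 1"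
  and scalar_add: "scalar (a + b) = scalar a + scalar b"
  and scalar_mult: "scalar (a * b) = scalar a * scalar b"
  by (simp_all add: scalar_def Const_add Const_mult fps_const_mult[symmetric] fps_const_add[symmetric]
      del: fps_const_mult fps_const_add)

lemma scalar_uminus: "scalar (- a) = - scalar a"
  by (simp add: scalar_def Const_def single_uminus)

lemma scalar_of_nat: "scalar (of_nat n) = of_nat n"
  by (induction n) (simp_all add: scalar_add)

lemma scalar_numeral: "scalar (numeral n) = numeral n"
  using scalar_of_nat[of "numeral n"] by simp

lemma fls_const_of_nat: "fls_const (of_nat n) = of_nat n"
  by (induction n) (simp_all flip: fls_plus_const)

lemma mat_series_add: "mat_series (a + b) M = mat_series a M + mat_series b M"
  by (simp add: mat_series_def vec_eq_iff fps_eq_iff sum.distrib Const_add distrib_right flip: fls_plus_const)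

lemma mat_series_scale:
  "mat_series (fps_const x * c) M $ i $ j = scalar (fls_const x) * mat_series c M $ i $ j"
  by (simp add: mat_series_def scalar_def fps_eq_iff sum_distrib_left Const_mult mult.assoc flip: fls_const_mult_const)

lemma mat_series_minus: "mat_series (- c) M = - mat_series c M"
proof -
  have "mat_series c M + mat_series (- c) M = 0"
    by (simp flip: mat_series_add) (simp add: mat_series_def vec_eq_iff fps_eq_iff)
  then show ?thesis by (metis minus_unique)
qed

lemma mat_series_1: "mat_series 1 M = mat 1"
proof -
  have "(\<Sum>k\<le>d. Const (fls_const (fps_nth 1 k)) * fps_nth (mat_power M k $ i $ j) d) = fps_nth (mat 1 $ i $ j) d" for i j d
    by (subst sum.atMost_shift) simp
  then show ?thesis by (simp add: mat_series_def vec_eq_iff fps_eq_iff)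
qed

lemma mat_series_X:
  fixes M :: "'i::finite graded^'i^'i"
  assumes M0: "\<And>i j. fps_nth (M $ i $ j) 0 = 0"
  shows "mat_series fps_X M = M"
proof -
  have "fps_nth (mat_series fps_X M $ i $ j) d = fps_nth (M $ i $ j) d" for i j d
  proof -
    have "fps_nth (mat_series fps_X M $ i $ j) d
        = (\<Sum>k\<le>Suc d. Const (fls_const (fps_nth fps_X k)) * fps_nth (mat_power M k $ i $ j) d)"
      by (rule mat_series_nth_approx[OF M0]) simp
    also have "\<dots> = (\<Sum>k\<le>Suc d. if k = 1 then fps_nth (mat_power M 1 $ i $ j) d else 0)"
      by (intro sum.cong) auto
    finally show ?thesis by (simp add: sum.delta)
  qed
  then show ?thesis by (simp add: vec_eq_iff fps_eq_iff)
qed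

lemma matrix_uminus_mult_left: "(- M) ** N = - (M ** N)"
  and matrix_uminus_mult_right: "M ** (- N) = - (M ** N)"
  for M :: "'a::comm_ring_1^'n^'m" and N :: "'a^'k^'n"
  by (simp_all add: matrix_matrix_mult_def vec_eq_iff sum_negf)

lemma mat_power_uminus:
  fixes M :: "'a::comm_ring_1^'i^'i"
  shows "mat_power (- M) k $ i $ j = (-1) ^ k * mat_power M k $ i $ j"
  by (induction k arbitrary: i) (simp_all add: matrix_matrix_mult_def sum_distrib_left sum_negf mult_ac)

lemma fps_power_minus_one_mult_nth:
  "fps_nth ((-1) ^ k * F :: 'a::comm_ring_1 fps) d = (-1) ^ k * fps_nth F d"
  by (cases "even k") simp_all

lemma Const_uminus_one_power: "Const (fls_const ((- 1) ^ k * c)) = (- 1) ^ k * Const (fls_const c)"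
  for c :: "'a::comm_ring_1"
proof -
  have "Const (fls_const (- c)) = - Const (fls_const c)"
    by (simp add: Const_def single_uminus)
  then show ?thesis by (cases "even k") simp_all
qed

text \<open>The sign moves from the matrix to the variable of the series, where parity can be
  applied.\<close>

lemma mat_series_uminus:
  "mat_series c (- M) = mat_series (fps_compose c (- fps_X)) M"
proof -
  have "Const (fls_const (fps_nth c k)) * fps_nth (mat_power (- M) k $ i $ j) d
      = Const (fls_const (fps_nth (fps_compose c (- fps_X)) k)) * fps_nth (mat_power M k $ i $ j) d" for i j k d
    by (simp only: mat_power_uminus fps_power_minus_one_mult_nth fps_compose_uminus' fps_nth_Abs_fps
        Const_uminus_one_power) (simp only: mult_ac)
  then show ?thesis by (simp only: mat_series_def)
qed

text \<open>The entries of \<open>M\<close> are homogeneous of degree two, so those of its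
  \<open>k\<close>-th power have degree \<open>2 * k\<close>, and \<open>X d/dX\<close> acting on
  \<open>c\<close> supplies the factor \<open>k\<close>.\<close>

lemma euler_mat_series:
  fixes M :: "'i::finite graded^'i^'i"
  assumes M: "\<And>i j. euler (M $ i $ j) = 2 * M $ i $ j"
  shows "euler (mat_series c M $ i $ j) = mat_series (2 * fps_X * fps_deriv c) M $ i $ j"
proof -
  have pow: "euler (mat_power M k $ i $ j) = of_nat (2 * k) * mat_power M k $ i $ j" for k i j
  proof (induction k arbitrary: i)
    case 0
    then show ?case by (simp add: mat_def derivation_0[OF derivation_euler] derivation_1[OF derivation_euler])
  next
    case (Suc k)
    then show ?case
      by (simp add: matrix_matrix_mult_def derivation_sum[OF derivation_euler] derivation_mult[OF derivation_euler]
          M sum_distrib_left sum.distrib algebra_simps)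
  qed
  have pow_nth: "of_nat d * fps_nth (mat_power M k $ i $ j) d = of_nat (2 * k) * fps_nth (mat_power M k $ i $ j) d" for d k
    using arg_cong[OF pow[of k i j], of "\<lambda>F. fps_nth F d"]
    by (simp add: euler_nth flip: fps_of_nat)
  have coeff: "Const (fls_const (fps_nth (2 * fps_X * fps_deriv c) k))
      = of_nat (2 * k) * (Const (fls_const (fps_nth c k)) :: ('i, complex fls) mpoly)" for k
  proof -
    have "fps_nth (2 * fps_X * fps_deriv c) k = of_nat (2 * k) * fps_nth c k"
      by (cases k) (simp_all add: mult.assoc numeral_fps_const)
    then show ?thesis
      by (simp only: fls_const_mult_const[symmetric] Const_mult fls_const_of_nat Const_of_nat)
  qed
  have "of_nat d * (Const (fls_const (fps_nth c k)) * fps_nth (mat_power M k $ i $ j) d)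
      = Const (fls_const (fps_nth (2 * fps_X * fps_deriv c) k)) * fps_nth (mat_power M k $ i $ j) d" for d k
    by (simp only: coeff mult.left_commute[of "of_nat d"] pow_nth) (simp only: mult_ac)
  then show ?thesis
    by (simp add: mat_series_def fps_eq_iff euler_nth sum_distrib_left)
qed

text \<open>The Leibniz rule kills the powers of \<open>M\<close>; causality extends this to the
  series through a partial sum that agrees with it up to degree \<open>n\<close>. Applied to
  \<open>Y\<close>, it makes all entries of series in \<open>\<Lambda> A\<close> Casimir
  functions.\<close>

lemma mat_series_derivation_eq_0:
  fixes M :: "'i::finite graded^'i^'i"
  assumes \<delta>: "derivation \<delta>" "causal \<delta>" and c: "\<And>i. \<delta> (scalar (fls_const (fps_nth c i))) = 0"
    and M: "\<And>i j. \<delta> (M $ i $ j) = 0" and M0: "\<And>i j. fps_nth (M $ i $ j) 0 = 0"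
  shows "\<delta> (mat_series c M $ i $ j) = 0"
proof (rule fps_ext)
  fix n
  have pow: "\<delta> (mat_power M k $ i $ j) = 0" for k i j
    by (induction k arbitrary: i)
       (simp_all add: mat_def matrix_matrix_mult_def derivation_sum[OF \<delta>(1)] derivation_mult[OF \<delta>(1)] M
         derivation_0[OF \<delta>(1)] derivation_1[OF \<delta>(1)])
  define p where "p = (\<Sum>k\<le>n. scalar (fls_const (fps_nth c k)) * mat_power M k $ i $ j)"
  have "\<forall>d\<le>n. fps_nth (mat_series c M $ i $ j - p) d = 0"
    by (simp add: mat_series_nth_approx[OF M0, of _ n] p_def scalar_def fps_sum_nth)
  then have "fps_nth (\<delta> (mat_series c M $ i $ j - p)) n = 0"
    using \<delta>(2) unfolding causal_def by blast
  moreover have "\<delta> p = 0"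
    by (simp add: p_def derivation_sum[OF \<delta>(1)] derivation_mult[OF \<delta>(1)] c pow)
  ultimately show "fps_nth (\<delta> (mat_series c M $ i $ j)) n = fps_nth 0 n"
    by (simp add: derivation_diff[OF \<delta>(1)])
qed

lemma derivation_subst_series:
  fixes x :: "'i::finite graded"
  assumes "derivation \<delta>" "causal \<delta>" "\<And>c. \<delta> (scalar c) = 0" "fps_nth x 0 = 0"
  shows "\<delta> (subst_series c x) = subst_series (fps_deriv c) x * \<delta> x"
proof -
  have "fps_deriv (Abs_fps (\<lambda>k. Const (fls_const (fps_nth c k))))
      = Abs_fps (\<lambda>k. Const (fls_const (fps_nth (fps_deriv c) k)) :: ('i, complex fls) mpoly)"
    by (rule fps_ext) (simp only: fps_deriv_nth fps_nth_Abs_fps fls_const_mult_const[symmetric] Const_mult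
        fls_const_of_nat Const_of_nat)
  then show ?thesis
    unfolding subst_series_def using assms
    by (subst derivation_fps_compose[of \<delta>]) (auto simp: scalar_def)
qed

lemma subst_series_scale:
  "subst_series (fps_const a * c) x = scalar (fls_const a) * subst_series c x"
  by (simp add: subst_series_def fps_eq_iff fps_compose_nth scalar_def sum_distrib_left Const_mult mult.assoc
      flip: fls_const_mult_const)

lemma subst_series_mult_1_plus_X:
  fixes x :: "'i::finite graded"
  assumes "fps_nth x 0 = 0"
  shows "subst_series (c * (1 + fps_X)) x = subst_series c x * (1 + x)"
proof -
  have "Abs_fps (\<lambda>k. Const (fls_const (fps_nth (c * (1 + fps_X)) k)))
      = Abs_fps (\<lambda>k. Const (fls_const (fps_nth c k))) * (1 + fps_X :: 'i graded)"
    by (rule fps_ext) (simp add: distrib_left Const_add flip: fls_plus_const)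
  then show ?thesis
    unfolding subst_series_def using fps_compose_mult_1_plus_X[OF assms] by metis
qed

section \<open>Hyperbolic series and homogeneous components\<close>

definition cosh_series :: "complex fps" where
  "cosh_series = fps_const (1/2) * (fps_exp 1 + fps_exp (- 1))"

definition sinh_series :: "complex fps" where
  "sinh_series = fps_const (1/2) * (fps_exp 1 - fps_exp (- 1))"

lemma fps_deriv_cosh_series: "fps_deriv cosh_series = sinh_series"
  by (simp add: cosh_series_def sinh_series_def flip: fps_const_neg)

lemma fps_deriv_sinh_series: "fps_deriv sinh_series = cosh_series"
  by (simp add: cosh_series_def sinh_series_def flip: fps_const_neg)

lemma cosh_series_nonzero: "cosh_series \<noteq> 0"
proof
  assume "cosh_series = 0"
  then have "fps_nth cosh_series 0 = 0" by simp
  then show False by (simp add: cosh_series_def)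
qed

text \<open>So \<open>tan_series\<close> is the hyperbolic tangent. Its parity and its differential
  equation follow below from this product by cancelling \<open>cosh_series\<close> in the integral
  domain of complex power series.\<close>

lemma tan_series_mult_cosh_series: "tan_series * cosh_series = sinh_series"
proof -
  have "fps_cos \<i> \<noteq> 0" "fps_nth (fps_cos \<i>) 0 \<noteq> (0::complex)"
    by (auto simp: fps_eq_iff fps_cos_def intro!: exI[of _ 0])
  then have "tan_series * fps_cos \<i> = fps_const (1 / \<i>) * fps_sin \<i>"
    by (simp add: tan_series_def fps_tan_def fps_divide_unit mult.assoc inverse_mult_eq_1)
  moreover have "fps_cos \<i> = cosh_series"
    unfolding fps_cos_fps_exp_ii cosh_series_def
    by (simp add: fps_divide_unit fps_const_inverse add.commute mult.commute)
  moreover have "fps_const (1 / \<i>) * fps_sin \<i> = sinh_series"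
    unfolding fps_sin_fps_exp_ii sinh_series_def
    by (simp add: fps_divide_unit fps_const_inverse mult.commute mult.left_commute algebra_simps)
       (simp add: fps_eq_iff field_simps)
  ultimately show ?thesis by simp
qed

lemma fps_exp_compose_uminus: "fps_compose (fps_exp a) (- fps_X) = fps_exp (- a :: 'a::field_char_0)"
  by (simp add: fps_compose_uminus' fps_eq_iff power_minus[of a] mult.commute)

lemma cosh_series_even: "fps_compose cosh_series (- fps_X) = cosh_series"
  and sinh_series_odd: "fps_compose sinh_series (- fps_X) = - sinh_series"
  unfolding cosh_series_def sinh_series_def
  by (simp_all add: fps_compose_mult_distrib fps_compose_add_distrib fps_compose_sub_distrib
      fps_exp_compose_uminus algebra_simps)

lemma tan_series_odd: "fps_compose tan_series (- fps_X) = - tan_series"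
proof -
  have "fps_compose tan_series (- fps_X) * cosh_series = - tan_series * cosh_series"
    using fps_compose_mult_distrib[of "- fps_X" tan_series cosh_series]
    by (simp add: tan_series_mult_cosh_series cosh_series_even sinh_series_odd)
  then show ?thesis
    using cosh_series_nonzero by (simp only: mult_cancel_right simp_thms)
qed

lemma tan_series_nth_0: "fps_nth tan_series 0 = 0"
  using tan_series_odd by (auto simp: fps_compose_uminus' fps_eq_iff dest: spec[of _ 0])

lemma tan_series_shift: "fps_X * fps_shift 1 tan_series = tan_series"
  using tan_series_nth_0 by (simp add: fps_eq_iff)

text \<open>An odd series divided by its variable is even; this is the source of the symmetry of the
  matrix \<open>T\<close>.\<close>

lemma tan_series_shift_even:
  "fps_compose (fps_shift 1 tan_series) (- fps_X) = fps_shift 1 tan_series"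
proof -
  have "- ((- 1) ^ n * fps_nth tan_series (Suc n)) = - fps_nth tan_series (Suc n)" for n
    using arg_cong[OF tan_series_odd, of "\<lambda>F. fps_nth F (Suc n)"]
    by (simp only: fps_compose_uminus' fps_nth_Abs_fps fps_neg_nth power_Suc mult_minus_left mult_1_left)
  then show ?thesis by (simp only: fps_compose_uminus' fps_eq_iff fps_nth_Abs_fps fps_shift_nth neg_equal_iff_equal
      Suc_eq_plus1 simp_thms)
qed

text \<open>Differentiate \<open>tan_series * cosh_series = sinh_series\<close>, replace
  \<open>sinh_series\<close> by the product again and cancel.\<close>

lemma fps_deriv_tan_series: "fps_deriv tan_series = 1 - tan_series * tan_series"
proof -
  have "fps_deriv tan_series * cosh_series + tan_series * sinh_series = cosh_series"
    using arg_cong[OF tan_series_mult_cosh_series, of fps_deriv]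
    by (simp add: fps_deriv_cosh_series fps_deriv_sinh_series add.commute)
  then have "fps_deriv tan_series * cosh_series = (1 - tan_series * tan_series) * cosh_series"
    by (simp add: algebra_simps flip: tan_series_mult_cosh_series)
  then show ?thesis
    using cosh_series_nonzero by (simp only: mult_cancel_right simp_thms)
qed

lemma fps_deriv_fps_binomial_mult:
  "fps_deriv (fps_binomial c) * (1 + fps_X) = fps_const c * fps_binomial (c::'a::field_char_0)"
  by (simp add: fps_binomial_deriv fps_divide_unit mult.assoc inverse_mult_eq_1)

section \<open>Homogeneous polynomials and formal sections\<close>

lemma hom_part_H0:
  assumes "p \<in> H0 k"
  shows "hom_part d p = (if d = k then p else 0)"
proof (cases "d = k")
  case True
  have "{m \<in> Poly_Mapping.keys p. mdeg m = k} = Poly_Mapping.keys p"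
    using assms by (auto simp: H0_def)
  then show ?thesis using True by (simp add: hom_part_def flip: mpoly_eq_sum_single)
next
  case False
  then have "{m \<in> Poly_Mapping.keys p. mdeg m = d} = {}"
    using assms by (auto simp: H0_def)
  then show ?thesis using False by (simp only: hom_part_def sum.empty if_False)
qed

lemma lookup_mu_poly: "Poly_Mapping.lookup (mu_poly p) m = fls_const (Poly_Mapping.lookup p m)"
  by (simp add: mu_poly_def Poly_Mapping.map.rep_eq when_def)

lemma mu_poly_H0: "p \<in> H0 k \<Longrightarrow> mu_poly p \<in> H0 k"
  by (auto simp: H0_def in_keys_iff lookup_mu_poly)

lemma mu_poly_0 [simp]: "mu_poly 0 = 0"
  by (rule poly_mapping_eqI) (simp add: lookup_mu_poly)

lemma mu_poly_add: "mu_poly (p + q) = mu_poly p + mu_poly q"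
  by (rule poly_mapping_eqI) (simp add: lookup_mu_poly lookup_add fls_plus_const)

lemma mu_poly_uminus: "mu_poly (- p) = - mu_poly p"
  by (rule poly_mapping_eqI) (simp add: lookup_mu_poly)

lemma mu_poly_sum: "mu_poly (sum f S) = (\<Sum>x\<in>S. mu_poly (f x))"
  by (induction S rule: infinite_finite_induct) (simp_all add: mu_poly_add)

lemma mu_poly_single: "mu_poly (Poly_Mapping.single m c) = Poly_Mapping.single m (fls_const c)"
  by (rule poly_mapping_eqI) (simp add: lookup_mu_poly lookup_single when_def)

lemma mu_poly_mult: "mu_poly (p * q) = mu_poly p * mu_poly q"
proof -
  have single: "mu_poly (p * Poly_Mapping.single n d) = mu_poly p * mu_poly (Poly_Mapping.single n d)" for p n and d :: complex
    by (induction p rule: mpoly_induct) (simp_all add: mult_single mu_poly_single mu_poly_add distrib_right)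
  show ?thesis
    by (induction q rule: mpoly_induct) (simp_all add: single mu_poly_add distrib_left)
qed

lemma mu_poly_Var: "mu_poly (Var i) = Var i"
  by (simp add: Var_def mu_poly_single)

lemma dZ_mu_poly: "dZ i (mu_poly p) = mu_poly (dZ i p)"
  by (rule poly_mapping_eqI)
     (simp only: lookup_mu_poly lookup_dZ fls_const_mult_const[symmetric] fls_const_of_nat)

lemma H0_0 [simp]: "0 \<in> H0 k"
  by (simp add: H0_def)

lemma H0_add: "p \<in> H0 k \<Longrightarrow> q \<in> H0 k \<Longrightarrow> p + q \<in> H0 k"
  using keys_add[of p q] by (auto simp: H0_def)

lemma H0_sum: "(\<And>x. x \<in> S \<Longrightarrow> f x \<in> H0 k) \<Longrightarrow> sum f S \<in> H0 k"
  by (induction S rule: infinite_finite_induct) (auto intro: H0_add)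

lemma mdeg_add: "mdeg (m + n) = mdeg m + mdeg n"
  by (simp add: mdeg_def lookup_add sum.distrib)

lemma H0_mult: "p \<in> H0 j \<Longrightarrow> q \<in> H0 k \<Longrightarrow> p * q \<in> H0 (j + k)"
  using keys_mult[of p q] by (fastforce simp: H0_def mdeg_add)

lemma H0_Const: "Const c \<in> H0 0"
  by (auto simp: H0_def Const_def mdeg_def)

lemma H0_Var: "Var i \<in> H0 1"
  by (auto simp: H0_def Var_def mdeg_def lookup_single when_def)

lemma formal_sections_add: "F \<in> formal_sections \<Longrightarrow> G \<in> formal_sections \<Longrightarrow> F + G \<in> formal_sections"
  by (simp add: formal_sections_def H0_add)

lemma formal_sections_mult: "F \<in> formal_sections \<Longrightarrow> G \<in> formal_sections \<Longrightarrow> F * G \<in> formal_sections"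
proof -
  assume FG: "F \<in> formal_sections" "G \<in> formal_sections"
  have "fps_nth F i * fps_nth G (n - i) \<in> H0 n" if "i \<le> n" for i n
    using H0_mult[of "fps_nth F i" i "fps_nth G (n - i)" "n - i"] FG that by (simp add: formal_sections_def)
  then show ?thesis by (auto simp: formal_sections_def fps_mult_nth intro!: H0_sum)
qed

lemma formal_sections_scalar: "scalar c \<in> formal_sections"
  by (simp add: formal_sections_def scalar_def H0_Const)

lemma formal_sections_0: "0 \<in> formal_sections" and formal_sections_1: "1 \<in> formal_sections"
  using formal_sections_scalar[of 0] formal_sections_scalar[of 1] by simp_all

lemma formal_sections_uminus: "F \<in> formal_sections \<Longrightarrow> - F \<in> formal_sections"
  using formal_sections_mult[OF formal_sections_scalar[of "- 1"], of F] by (simp add: scalar_uminus)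

lemma formal_sections_sum: "(\<And>x. x \<in> S \<Longrightarrow> f x \<in> formal_sections) \<Longrightarrow> sum f S \<in> formal_sections"
  by (induction S rule: infinite_finite_induct) (auto intro: formal_sections_add formal_sections_0)

lemma formal_sections_prod: "(\<And>x. x \<in> S \<Longrightarrow> f x \<in> formal_sections) \<Longrightarrow> prod f S \<in> formal_sections"
  by (induction S rule: infinite_finite_induct) (auto intro: formal_sections_mult formal_sections_1)

lemma formal_sections_power: "F \<in> formal_sections \<Longrightarrow> F ^ n \<in> formal_sections"
  by (induction n) (auto intro: formal_sections_mult formal_sections_1)

lemma formal_sections_det: "(\<And>i j. M $ i $ j \<in> formal_sections) \<Longrightarrow> det M \<in> formal_sections"
  unfolding det_def
  by (intro formal_sections_sum formal_sections_mult formal_sections_prod)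
     (auto simp: sign_def intro: formal_sections_1 formal_sections_uminus)

lemma formal_sections_subst_series:
  assumes "x \<in> formal_sections"
  shows "subst_series c x \<in> formal_sections"
proof -
  have "Const a * fps_nth (x ^ i) n \<in> H0 n" for a i n
    using H0_mult[OF H0_Const, of "fps_nth (x ^ i) n" n] formal_sections_power[OF assms, of i]
    by (simp add: formal_sections_def)
  then show ?thesis
    by (auto simp: formal_sections_def subst_series_def fps_compose_nth intro!: H0_sum)
qed

lemma formal_sections_matrix_mult:
  "(\<And>i j. M $ i $ j \<in> formal_sections) \<Longrightarrow> (\<And>i j. N $ i $ j \<in> formal_sections)
    \<Longrightarrow> (M ** N) $ i $ j \<in> formal_sections"
  by (simp add: matrix_matrix_mult_def formal_sections_sum formal_sections_mult)

lemma formal_sections_mat_series: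
  assumes "\<And>i j. M $ i $ j \<in> formal_sections"
  shows "mat_series c M $ i $ j \<in> formal_sections"
proof -
  have pow: "mat_power M k $ i $ j \<in> formal_sections" for k i j
    by (induction k arbitrary: i j)
       (auto simp: mat_def intro: formal_sections_0 formal_sections_1 formal_sections_matrix_mult assms)
  have "Const a * fps_nth (mat_power M k $ i $ j) n \<in> H0 n" for a k n
    using H0_mult[OF H0_Const, of "fps_nth (mat_power M k $ i $ j) n" n] pow[of k i j]
    by (simp add: formal_sections_def)
  then show ?thesis
    by (auto simp: formal_sections_def mat_series_def intro!: H0_sum)
qed

lemma formal_sections_to_graded: "to_graded p \<in> formal_sections"
  by (auto simp: formal_sections_def to_graded_def hom_part_def H0_def lookup_sum lookup_single when_def
      in_keys_iff elim!: sum.not_neutral_contains_not_neutral split: if_splits)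

lemma formal_sections_quad_form:
  "(\<And>i j. M $ i $ j \<in> formal_sections) \<Longrightarrow> quad_form M \<in> formal_sections"
  unfolding quad_form_def
  by (intro formal_sections_sum formal_sections_mult formal_sections_to_graded) auto

section \<open>The product with a quadratic form\<close>

lemma dZs_eq_0:
  assumes "\<And>a b c. dZ a (dZ b (dZ c f)) = 0" "3 \<le> length as"
  shows "dZs as f = (0 :: ('i, 'a::comm_ring_1) mpoly)"
  using assms(2)
proof (induction as)
  case (Cons a as)
  show ?case
  proof (cases "3 \<le> length as")
    case True
    then show ?thesis using Cons.IH by (simp add: dZs_def derivation_0[OF derivation_dZ])
  next
    case False
    then have "length as = 2" using Cons.prems by simp
    then obtain b c where "as = [b, c]" by (auto simp: numeral_2_eq_2 length_Suc_conv)
    then show ?thesis by (simp add: dZs_def assms(1))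
  qed
qed simp

text \<open>All terms with \<open>k \<ge> 3\<close> contain a derivative of \<open>f\<close> of
  order at least three, so the series of the star product stops at \<open>k = 2\<close>.\<close>

lemma star_poly_quadratic:
  fixes L :: "('i::finite, complex) mpoly^'i^'i"
  assumes "\<And>a b c. dZ a (dZ b (dZ c f)) = 0"
  defines "L' \<equiv> \<chi> \<alpha> \<beta>. mu_poly (L $ \<alpha> $ \<beta>)"
  shows "star_poly L f g = f * g + Const (fls_X * fls_const (1/2)) * bracket L' f g
    + Const (fls_const (1/2) * (fls_X * fls_const (1/2)) ^ 2) * bidiff L' 2 f g"
proof -
  have "bidiff L' k f g = 0" if "3 \<le> k" for k
    unfolding bidiff_def using that
    by (intro sum.neutral ballI) (simp add: indices_def dZs_eq_0[OF assms(1)])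
  then have zero: "bidiff L' k f g = 0" if "k \<noteq> 0" "k \<noteq> 1" "k \<noteq> 2" for k
    using that by (auto simp: numeral_2_eq_2 numeral_3_eq_3 not_less_eq_eq[symmetric] le_Suc_eq)
  then have "star_poly L f g = (\<Sum>k\<in>{0, 1, 2}. Const (fls_const (1 / fact k) * (fls_X * fls_const (1/2)) ^ k)
      * bidiff L' k f g)"
    unfolding star_poly_def L'_def[symmetric]
  proof (intro Sum_any.expand_superset subsetI)
    fix k
    assume "k \<in> {k. Const (fls_const (1 / fact k) * (fls_X * fls_const (1/2)) ^ k) * bidiff L' k f g \<noteq> 0}"
    then show "k \<in> {0, 1, 2}"
      using zero[of k] by (cases "k = 0"; cases "k = 1"; cases "k = 2") auto
  qed simp
  then show ?thesis by (simp add: bidiff_0 bidiff_1 add.assoc)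
qed

lemma star_poly_0: "star_poly L 0 g = 0"
  using star_poly_quadratic[of 0 L g]
  by (simp add: derivation_0[OF derivation_dZ] bracket_def bidiff_2)

lemma bracket_eq_ham: "bracket L f g = (\<Sum>\<alpha>\<in>UNIV. dZ \<alpha> f * ham L \<alpha> g)"
  by (simp add: bracket_def ham_def sum_distrib_left mult_ac)

text \<open>In a composition of two Hamiltonian derivations the outer one passes through the Casimir
  coefficients of the inner one, so no derivatives of coefficients appear.\<close>

lemma bidiff_2_eq_ham:
  assumes casimir: "\<And>\<alpha> \<beta> \<gamma>. ham L \<alpha> (L $ \<beta> $ \<gamma>) = 0"
  shows "bidiff L 2 f g = (\<Sum>\<alpha>\<in>UNIV. \<Sum>\<alpha>'\<in>UNIV. dZ \<alpha> (dZ \<alpha>' f) * ham L \<alpha> (ham L \<alpha>' g))"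
proof -
  have "ham L \<alpha> (ham L \<alpha>' g) = (\<Sum>\<beta>'\<in>UNIV. L $ \<alpha>' $ \<beta>' * (\<Sum>\<beta>\<in>UNIV. L $ \<alpha> $ \<beta> * dZ \<beta> (dZ \<beta>' g)))" for \<alpha> \<alpha>'
  proof -
    have "ham L \<alpha> (\<Sum>\<beta>'\<in>UNIV. L $ \<alpha>' $ \<beta>' * dZ \<beta>' g) = (\<Sum>\<beta>'\<in>UNIV. L $ \<alpha>' $ \<beta>' * ham L \<alpha> (dZ \<beta>' g))"
      by (simp only: derivation_sum[OF derivation_ham] derivation_mult[OF derivation_ham] casimir mult_zero_left add_0)
    then show ?thesis by (simp only: ham_def)
  qed
  also have "(\<Sum>\<beta>'\<in>UNIV. L $ \<alpha>' $ \<beta>' * (\<Sum>\<beta>\<in>UNIV. L $ \<alpha> $ \<beta> * dZ \<beta> (dZ \<beta>' g)))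
      = (\<Sum>\<beta>\<in>UNIV. \<Sum>\<beta>'\<in>UNIV. L $ \<alpha> $ \<beta> * L $ \<alpha>' $ \<beta>' * dZ \<beta> (dZ \<beta>' g))" for \<alpha> \<alpha>'
    unfolding sum_distrib_left by (subst sum.swap) (simp add: mult_ac)
  finally show ?thesis
    by (simp add: bidiff_2 sum_distrib_left mult_ac)
qed

section \<open>Graded normal forms and quadratic forms\<close>

lemma map_coeffs_X_power:
  fixes \<delta> :: "'a::comm_ring_1 \<Rightarrow> 'a"
  assumes "derivation \<delta>"
  shows "map_coeffs \<delta> (fps_X ^ k * F) = fps_X ^ k * map_coeffs \<delta> F"
  by (rule fps_ext) (simp add: fps_X_power_mult_nth derivation_0[OF assms])

lemma map_coeffs_const:
  fixes \<delta> :: "'a::comm_ring_1 \<Rightarrow> 'a"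
  assumes "derivation \<delta>"
  shows "map_coeffs \<delta> (fps_const p) = fps_const (\<delta> p)"
  by (rule fps_ext) (simp add: derivation_0[OF assms])

text \<open>In this normal form, one power of \<open>X\<close> times a constant series,
  \<open>euler\<close> and \<open>Y\<close> can be evaluated directly.\<close>

lemma to_graded_H0:
  assumes "p \<in> H0 k"
  shows "to_graded p = fps_X ^ k * fps_const (mu_poly p)"
  by (rule fps_ext) (simp add: to_graded_def hom_part_H0[OF mu_poly_H0[OF assms]] fps_X_power_mult_nth)

lemma euler_X_power_const: "euler (fps_X ^ k * fps_const p) = of_nat k * (fps_X ^ k * fps_const p)"
  by (rule fps_ext) (simp add: euler_nth fps_X_power_mult_nth flip: fps_of_nat)

lemma quad_form_add: "quad_form (M + N) = quad_form M + quad_form N"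
  by (simp add: quad_form_def distrib_left distrib_right sum.distrib)

lemma quad_form_uminus: "quad_form (- M) = - quad_form M"
  by (simp add: quad_form_def sum_negf)

lemma quad_form_transpose: "quad_form (transpose M) = quad_form M"
  unfolding quad_form_def by (subst sum.swap) (simp add: transpose_def mult_ac)

lemma sum_mult_vector_eq_quad_form:
  "(\<Sum>\<alpha>\<in>UNIV. (\<Sum>\<beta>\<in>UNIV. M $ \<alpha> $ \<beta> * to_graded (Var \<beta>)) * (\<Sum>\<gamma>\<in>UNIV. N $ \<alpha> $ \<gamma> * to_graded (Var \<gamma>)))
    = quad_form (transpose M ** N)"
proof -
  have "(\<Sum>\<alpha>\<in>UNIV. (\<Sum>\<beta>\<in>UNIV. M $ \<alpha> $ \<beta> * to_graded (Var \<beta>)) * (\<Sum>\<gamma>\<in>UNIV. N $ \<alpha> $ \<gamma> * to_graded (Var \<gamma>)))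
      = (\<Sum>\<alpha>\<in>UNIV. \<Sum>\<beta>\<in>UNIV. \<Sum>\<gamma>\<in>UNIV. to_graded (Var \<beta>) * (M $ \<alpha> $ \<beta> * N $ \<alpha> $ \<gamma>) * to_graded (Var \<gamma>))"
    by (simp add: sum_product mult_ac)
  also have "\<dots> = (\<Sum>\<beta>\<in>UNIV. \<Sum>\<alpha>\<in>UNIV. \<Sum>\<gamma>\<in>UNIV. to_graded (Var \<beta>) * (M $ \<alpha> $ \<beta> * N $ \<alpha> $ \<gamma>) * to_graded (Var \<gamma>))"
    by (rule sum.swap)
  also have "\<dots> = (\<Sum>\<beta>\<in>UNIV. \<Sum>\<gamma>\<in>UNIV. \<Sum>\<alpha>\<in>UNIV. to_graded (Var \<beta>) * (M $ \<alpha> $ \<beta> * N $ \<alpha> $ \<gamma>) * to_graded (Var \<gamma>))"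
    by (rule sum.cong[OF refl]) (rule sum.swap)
  finally show ?thesis
    by (simp add: quad_form_def matrix_matrix_mult_def transpose_def sum_distrib_left sum_distrib_right)
qed

text \<open>Taking the constant coefficient is a ring homomorphism. This will show that
  \<open>det C - 1\<close> may be substituted into the binomial series.\<close>

lemma fps_nth_det_0: "fps_nth (det M) 0 = det (\<chi> i j. fps_nth (M $ i $ j) 0)"
proof -
  have prod: "fps_nth (prod f S) 0 = (\<Prod>x\<in>S. fps_nth (f x) 0)" for f :: "'b \<Rightarrow> 'a::comm_ring_1 fps" and S
    by (induction S rule: infinite_finite_induct) simp_all
  have "fps_nth (of_int (sign p)) 0 = (of_int (sign p) :: 'a::comm_ring_1)" for p :: "'b \<Rightarrow> 'b"
    by (simp add: sign_def)
  then show ?thesis by (simp add: det_def fps_sum_nth prod)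
qed

lemma subst_series_nth_0: "fps_nth (subst_series c x) 0 = Const (fls_const (fps_nth c 0))"
  by (simp add: subst_series_def)

lemma mat_series_nth_0: "fps_nth (mat_series c M $ i $ j) 0 = (if i = j then Const (fls_const (fps_nth c 0)) else 0)"
  by (simp add: mat_series_def mat_def)

text \<open>The condition \<open>casimir\<close> stands in for the Jacobi rule and the assumption on
  arrows, from which \<open>ham_entry_eq_0\<close> derives it.\<close>

locale casimir_star =
  fixes l :: "('i::finite, complex) mpoly^'i^'i" and A :: "complex^'i^'i"
  assumes skew: "\<And>\<alpha> \<beta>. l $ \<alpha> $ \<beta> = - (l $ \<beta> $ \<alpha>)"
    and order_zero: "\<And>\<alpha> \<beta>. l $ \<alpha> $ \<beta> \<in> H0 2"
    and casimir: "\<And>\<alpha> \<beta> \<gamma>. ham l \<alpha> (l $ \<beta> $ \<gamma>) = 0"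
    and A_sym: "transpose A = A"
begin

definition l' :: "('i, complex fls) mpoly^'i^'i" where
  "l' = (\<chi> \<alpha> \<beta>. mu_poly (l $ \<alpha> $ \<beta>))"

text \<open>The factor \<open>X\<close> accounts for the fact that \<open>ham l' \<alpha>\<close> raises the degree in \<open>Z\<close> by one.\<close>

definition Y :: "'i \<Rightarrow> 'i graded \<Rightarrow> 'i graded" where
  "Y \<alpha> F = fps_X * map_coeffs (ham l' \<alpha>) F"

abbreviation z :: "'i \<Rightarrow> 'i graded" where "z \<alpha> \<equiv> to_graded (Var \<alpha>)"
abbreviation Lam :: "'i graded^'i^'i" where "Lam \<equiv> Lambda_mat l"
abbreviation Ac :: "'i graded^'i^'i" where "Ac \<equiv> const_mat A"
abbreviation B :: "'i graded^'i^'i" where "B \<equiv> Lam ** Ac"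

lemma ham_l'_entry: "ham l' \<alpha> (l' $ \<beta> $ \<gamma>) = 0"
proof -
  have "ham l' \<alpha> (mu_poly p) = mu_poly (ham l \<alpha> p)" for p
    by (simp add: ham_def l'_def dZ_mu_poly mu_poly_sum mu_poly_mult)
  then show ?thesis by (simp add: l'_def casimir)
qed

lemma derivation_Y: "derivation (Y \<alpha>)"
  unfolding Y_def[abs_def] by (intro derivation_mult_left derivation_map_coeffs derivation_ham)

lemma causal_Y: "causal (Y \<alpha>)"
  unfolding Y_def[abs_def] by (intro causal_mult_left causal_map_coeffs derivation_ham)

lemmas Y_rules = derivation_add[OF derivation_Y] derivation_mult[OF derivation_Y]
  derivation_sum[OF derivation_Y] derivation_0[OF derivation_Y] derivation_1[OF derivation_Y]

lemmas euler_rules = derivation_add[OF derivation_euler] derivation_mult[OF derivation_euler]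
  derivation_sum[OF derivation_euler] derivation_0[OF derivation_euler] derivation_1[OF derivation_euler]

lemma Y_X_power_const: "Y \<alpha> (fps_X ^ k * fps_const p) = fps_X ^ Suc k * fps_const (ham l' \<alpha> p)"
  by (simp add: Y_def map_coeffs_X_power[OF derivation_ham] map_coeffs_const[OF derivation_ham] mult.assoc)

lemma Lam_eq: "Lam $ \<alpha> $ \<beta> = fps_X ^ 2 * fps_const (l' $ \<alpha> $ \<beta>)"
  by (simp add: Lambda_mat_def to_graded_H0[OF order_zero] l'_def)

lemma z_eq: "z \<alpha> = fps_X ^ 1 * fps_const (Var \<alpha>)"
  using to_graded_H0[OF H0_Var, of \<alpha>] by (simp add: mu_poly_Var)

lemma Y_z: "Y \<alpha> (z \<beta>) = Lam $ \<alpha> $ \<beta>"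
  unfolding z_eq Lam_eq Y_X_power_const by (simp add: ham_Var numeral_2_eq_2)

lemma Y_Lam: "Y \<alpha> (Lam $ \<beta> $ \<gamma>) = 0"
  unfolding Lam_eq Y_X_power_const by (simp add: ham_l'_entry)

lemma Y_scalar: "Y \<alpha> (scalar c) = 0"
  using Y_X_power_const[of \<alpha> 0 "Const c"] by (simp add: scalar_def ham_def dZ_Const)

lemma Y_Ac: "Y \<alpha> (Ac $ \<beta> $ \<gamma>) = 0"
  by (simp add: const_mat_def Y_scalar)

lemma Y_B: "Y \<alpha> (B $ \<beta> $ \<gamma>) = 0"
  by (simp add: matrix_matrix_mult_def Y_rules Y_Lam Y_Ac)

lemma euler_scalar: "euler (scalar c) = 0"
  using euler_X_power_const[of 0 "Const c"] by (simp add: scalar_def)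

lemma euler_z: "euler (z \<alpha>) = z \<alpha>"
  unfolding z_eq euler_X_power_const by simp

lemma euler_Lam: "euler (Lam $ \<beta> $ \<gamma>) = 2 * Lam $ \<beta> $ \<gamma>"
  unfolding Lam_eq euler_X_power_const by simp

lemma euler_B: "euler (B $ \<beta> $ \<gamma>) = 2 * B $ \<beta> $ \<gamma>"
  by (simp add: matrix_matrix_mult_def euler_rules euler_Lam const_mat_def euler_scalar
      sum_distrib_left mult.assoc)

lemma Lam_nth_0: "fps_nth (Lam $ \<alpha> $ \<beta>) 0 = 0"
  by (simp add: Lam_eq fps_mult_nth)

lemma B_nth_0: "fps_nth (B $ \<alpha> $ \<beta>) 0 = 0"
  by (simp add: matrix_matrix_mult_def fps_sum_nth Lam_nth_0)

lemma z_nth_0: "fps_nth (z \<alpha>) 0 = 0"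
  by (simp add: z_eq)

section \<open>Transposition of series in \<open>\<Lambda> A\<close>\<close>

lemma transpose_Lam: "transpose Lam = - Lam"
proof -
  have entry: "Lam $ \<beta> $ \<alpha> = - (Lam $ \<alpha> $ \<beta>)" for \<alpha> \<beta>
  proof -
    have "mu_poly (l $ \<beta> $ \<alpha>) = - mu_poly (l $ \<alpha> $ \<beta>)"
      by (subst skew) (rule mu_poly_uminus)
    then show ?thesis
      by (simp only: Lam_eq l'_def vec_lambda_beta fps_const_neg[symmetric] mult_minus_right)
  qed
  have "transpose Lam $ i $ j = (- Lam) $ i $ j" for i j
    using entry[of j i] by (simp only: transpose_def vec_lambda_beta vector_uminus_component)
  then show ?thesis by (simp only: vec_eq_iff) blast
qed

lemma transpose_Ac: "transpose Ac = Ac"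
  using A_sym by (simp add: transpose_def vec_eq_iff const_mat_def)

lemma transpose_B: "transpose B = - (Ac ** Lam)"
  by (simp add: matrix_transpose_mul transpose_Lam transpose_Ac matrix_uminus_mult_right)

text \<open>Reversing the word \<open>A \<Lambda> A ... \<Lambda> A\<close> gives the same word,
  with one sign for each \<open>\<Lambda>\<close>. Hence even series give symmetric matrices and odd
  series skew ones.\<close>

lemma transpose_Ac_mat_series:
  "transpose (Ac ** mat_series c B) = Ac ** mat_series (fps_compose c (- fps_X)) B"
proof -
  have pow: "transpose (Ac ** mat_power B k) = Ac ** mat_power (- B) k" for k
  proof (induction k)
    case 0
    then show ?case by (simp add: transpose_Ac)
  next
    case (Suc k)
    have "transpose (N ** mat_power M (Suc k)) = transpose M ** transpose (N ** mat_power M k)"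
      for M N :: "'i graded^'i^'i"
      by (simp only: mat_power_Suc' matrix_mul_assoc matrix_transpose_mul[of _ M])
    from this[of Ac B] show ?case
      by (simp add: Suc transpose_B matrix_uminus_mult_left matrix_uminus_mult_right matrix_mul_assoc)
  qed
  have "fps_nth (transpose (Ac ** mat_series c B) $ i $ j) d = fps_nth ((Ac ** mat_series c (- B)) $ i $ j) d" for i j d
  proof -
    have "(Ac ** mat_power B k) $ j $ i = (Ac ** mat_power (- B) k) $ i $ j" for k
      by (simp add: transpose_def flip: pow)
    then show ?thesis
      by (simp add: transpose_def mult_mat_series_nth B_nth_0)
  qed
  then show ?thesis by (simp add: vec_eq_iff fps_eq_iff flip: mat_series_uminus)
qed

text \<open>The word \<open>\<Lambda> A ... \<Lambda> A \<Lambda>\<close> is again palindromic but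
  has one more \<open>\<Lambda>\<close>, so here odd series give symmetric matrices.\<close>

lemma transpose_mat_series_Lam:
  "transpose (mat_series c B ** Lam) = - (mat_series (fps_compose c (- fps_X)) B ** Lam)"
proof -
  have pow: "transpose (mat_power B k ** Lam) = - (mat_power (- B) k ** Lam)" for k
  proof (induction k)
    case 0
    then show ?case by (simp add: transpose_Lam)
  next
    case (Suc k)
    have "transpose (mat_power M (Suc k) ** N) = transpose (mat_power M k ** N) ** transpose M"
      for M N :: "'i graded^'i^'i"
      by (simp only: mat_power.simps matrix_mul_assoc[symmetric] matrix_transpose_mul[of M])
    from this[of B Lam] show ?case
      by (simp only: Suc transpose_B mat_power_Suc' matrix_uminus_mult_left matrix_uminus_mult_right matrix_mul_assoc)
  qed
  have "fps_nth (transpose (mat_series c B ** Lam) $ i $ j) d = fps_nth (- (mat_series c (- B) ** Lam) $ i $ j) d" for i j d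
  proof -
    have "(mat_power B k ** Lam) $ j $ i = - ((mat_power (- B) k ** Lam) $ i $ j)" for k
      using pow[of k] by (simp add: transpose_def vec_eq_iff)
    then show ?thesis
      by (simp add: transpose_def mat_series_mult_nth B_nth_0 sum_negf)
  qed
  then show ?thesis by (simp add: vec_eq_iff fps_eq_iff flip: mat_series_uminus)
qed

section \<open>Left star multiplication by \<open>F0\<close>\<close>

definition F0 :: "'i graded" where "F0 = scalar (1 / fls_X) * quad_form Ac"

text \<open>The polynomial \<open>A[Z]/\<mu>\<close> itself; \<open>F0\<close> is this polynomial
  placed in degree two, which reduces \<open>star\<close> by \<open>F0\<close> to
  \<open>star_poly\<close> by \<open>a0\<close>.\<close>

definition a0 :: "('i, complex fls) mpoly" where
  "a0 = (\<Sum>\<alpha>\<in>UNIV. \<Sum>\<beta>\<in>UNIV. Const (1 / fls_X * fls_const (A $ \<alpha> $ \<beta>)) * (Var \<alpha> * Var \<beta>))"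

lemma F0_eq: "F0 = fps_X ^ 2 * fps_const a0"
proof -
  have const_sum: "fps_const (sum f S) = (\<Sum>x\<in>S. fps_const (f x))" for f :: "'i \<Rightarrow> ('i, complex fls) mpoly" and S
    by (rule fps_ext) (simp add: fps_sum_nth)
  show ?thesis
    unfolding F0_def quad_form_def z_eq a0_def const_sum scalar_def const_mat_def
    by (simp add: sum_distrib_left Const_mult power2_eq_square mult_ac flip: fps_const_mult)
qed

text \<open>The product rule gives a row sum and a column sum of \<open>A\<close>, which agree by
  symmetry; hence the factor 2.\<close>

lemma dZ_a0: "dZ \<alpha> a0 = Const (2 / fls_X) * (\<Sum>\<beta>\<in>UNIV. Const (fls_const (A $ \<alpha> $ \<beta>)) * Var \<beta>)"
proof -
  have sym: "A $ \<beta> $ \<alpha> = A $ \<alpha> $ \<beta>" for \<alpha> \<beta>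
    using A_sym by (metis transpose_def vec_lambda_beta)
  let ?c = "\<lambda>\<alpha> \<beta>. Const (1 / fls_X * fls_const (A $ \<alpha> $ \<beta>)) :: ('i, complex fls) mpoly"
  have "dZ \<alpha> a0 = (\<Sum>\<gamma>\<in>UNIV. \<Sum>\<beta>\<in>UNIV. ?c \<gamma> \<beta> * (Var \<beta> * (if \<gamma> = \<alpha> then 1 else 0)))
      + (\<Sum>\<gamma>\<in>UNIV. \<Sum>\<beta>\<in>UNIV. ?c \<gamma> \<beta> * (Var \<gamma> * (if \<beta> = \<alpha> then 1 else 0)))"
    unfolding a0_def
    by (simp add: derivation_sum[OF derivation_dZ] derivation_mult[OF derivation_dZ] dZ_Const dZ_Var
        sum.distrib distrib_left eq_commute[of \<alpha>] if_distrib[of "\<lambda>x. x * _"] if_distrib[of "\<lambda>x. _ * x"] cong: if_cong)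
  also have "\<dots> = (\<Sum>\<beta>\<in>UNIV. ?c \<alpha> \<beta> * Var \<beta>) + (\<Sum>\<gamma>\<in>UNIV. ?c \<gamma> \<alpha> * Var \<gamma>)"
    by (subst sum.swap) (simp only: sum_mult_delta mult.assoc[symmetric])
  also have "\<dots> = Const (2 / fls_X) * (\<Sum>\<beta>\<in>UNIV. Const (fls_const (A $ \<alpha> $ \<beta>)) * Var \<beta>)"
  proof -
    have two: "Const (2 / fls_X) = Const (1 / fls_X) + (Const (1 / fls_X) :: ('i, complex fls) mpoly)"
      by (simp only: Const_add[symmetric] add_divide_distrib[symmetric] one_add_one)
    show ?thesis
      by (simp only: sym[of _ \<alpha>] two Const_mult sum_distrib_left distrib_right mult.assoc sum.distrib)
  qed
  finally show ?thesis .
qed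

lemma dZ_dZ_a0: "dZ \<alpha> (dZ \<beta> a0) = Const (2 / fls_X) * Const (fls_const (A $ \<alpha> $ \<beta>))"
proof -
  have sym: "A $ \<beta> $ \<alpha> = A $ \<alpha> $ \<beta>"
    using A_sym by (metis transpose_def vec_lambda_beta)
  have "dZ \<alpha> (dZ \<beta> a0) = Const (2 / fls_X) * (\<Sum>\<gamma>\<in>UNIV. Const (fls_const (A $ \<beta> $ \<gamma>)) * (if \<gamma> = \<alpha> then 1 else 0))"
    unfolding dZ_a0
    by (simp add: derivation_sum[OF derivation_dZ] derivation_mult[OF derivation_dZ] dZ_Const dZ_Var eq_commute[of \<alpha>])
  then show ?thesis by (simp only: sum_mult_delta sym)
qed

lemma dZ3_a0: "dZ \<gamma> (dZ \<alpha> (dZ \<beta> a0)) = 0"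
  by (simp add: dZ_dZ_a0 derivation_mult[OF derivation_dZ] dZ_Const)

lemma star_poly_a0:
  "star_poly l a0 g = a0 * g
    + (\<Sum>\<alpha>\<in>UNIV. (\<Sum>\<beta>\<in>UNIV. Const (fls_const (A $ \<alpha> $ \<beta>)) * Var \<beta>) * ham l' \<alpha> g)
    + Const (fls_X * fls_const (1/4)) * (\<Sum>\<alpha>\<in>UNIV. \<Sum>\<beta>\<in>UNIV. Const (fls_const (A $ \<alpha> $ \<beta>)) * ham l' \<alpha> (ham l' \<beta> g))"
proof -
  have half: "fls_const (1/2) * 2 = (1 :: complex fls)"
    using fls_const_mult_const[of "1/2" "2 :: complex"] by simp
  have quarter: "fls_const (1/4) = fls_const (1/2) * (fls_const (1/2) :: complex fls)"
    by (simp only: fls_const_mult_const) simp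
  \<comment> \<open>The weights of the first and second order terms, computed for general field
    elements and then specialised to \<open>x = \<mu>\<close> and \<open>h = 1/2\<close>. The factor
    \<open>2 / x\<close> comes from the derivatives of \<open>a0\<close>.\<close>
  have "x * h * (2 / x) = 1" "h * (x * h) ^ 2 * (2 / x) = x * (h * h)" if "x \<noteq> 0" "h * 2 = 1" for x h :: "complex fls"
    using that by (simp_all add: field_simps power2_eq_square)
  note * = this[OF fls_X_nonzero half]
  have c1: "fls_X * fls_const (1/2) * (2 / fls_X) = (1 :: complex fls)"
    by (rule *)
  have c2: "fls_const (1/2) * (fls_X * fls_const (1/2)) ^ 2 * (2 / fls_X) = fls_X * fls_const (1/4 :: complex)"
    unfolding quarter by (rule *)
  define v where "v = (\<lambda>\<alpha>. \<Sum>\<beta>\<in>UNIV. Const (fls_const (A $ \<alpha> $ \<beta>)) * Var \<beta> :: ('i, complex fls) mpoly)"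
  have dZ_v: "dZ \<alpha> a0 = Const (2 / fls_X) * v \<alpha>" for \<alpha>
    by (simp only: dZ_a0 v_def)
  have "star_poly l a0 g = a0 * g
    + (Const (fls_X * fls_const (1/2)) * Const (2 / fls_X)) * (\<Sum>\<alpha>\<in>UNIV. v \<alpha> * ham l' \<alpha> g)
    + (Const (fls_const (1/2) * (fls_X * fls_const (1/2)) ^ 2) * Const (2 / fls_X))
      * (\<Sum>\<alpha>\<in>UNIV. \<Sum>\<beta>\<in>UNIV. Const (fls_const (A $ \<alpha> $ \<beta>)) * ham l' \<alpha> (ham l' \<beta> g))"
    unfolding star_poly_quadratic[OF dZ3_a0] l'_def[symmetric] bidiff_2_eq_ham[OF ham_l'_entry] bracket_eq_ham
      dZ_dZ_a0 unfolding dZ_v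
    by (simp only: sum_distrib_left mult.assoc)
  then show ?thesis by (simp only: Const_mult[symmetric] c1 c2 Const_1 mult_1_left v_def)
qed

text \<open>Only the component of \<open>F0\<close> of degree two is nonzero, so the convolution has
  a single term and shifts the degree by two.\<close>

lemma star_F0_eq: "star l F0 G = fps_X ^ 2 * map_coeffs (star_poly l a0) G"
proof (rule fps_ext)
  fix n
  have "fps_nth (star l F0 G) n = (\<Sum>i\<le>n. if i = 2 then star_poly l a0 (fps_nth G (n - 2)) else 0)"
    unfolding star_def fps_nth_Abs_fps
    by (intro sum.cong) (auto simp: F0_eq fps_X_power_mult_nth star_poly_0)
  then show "fps_nth (star l F0 G) n = fps_nth (fps_X ^ 2 * map_coeffs (star_poly l a0) G) n"
    by (auto simp: sum.delta fps_X_power_mult_nth)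
qed

lemma star_F0:
  "star l F0 G = F0 * G + (\<Sum>\<alpha>\<in>UNIV. (\<Sum>\<beta>\<in>UNIV. Ac $ \<alpha> $ \<beta> * z \<beta>) * Y \<alpha> G)
    + scalar (fls_X * fls_const (1/4)) * (\<Sum>\<alpha>\<in>UNIV. \<Sum>\<beta>\<in>UNIV. Ac $ \<alpha> $ \<beta> * Y \<alpha> (Y \<beta> G))"
proof -
  let ?S = "map_coeffs (star_poly l a0) G"
  have "star l F0 G = fps_X ^ 2 * ?S"
    by (rule star_F0_eq)
  moreover have "?S = fps_const a0 * G
      + (\<Sum>\<alpha>\<in>UNIV. (\<Sum>\<beta>\<in>UNIV. Ac $ \<alpha> $ \<beta> * fps_const (Var \<beta>)) * map_coeffs (ham l' \<alpha>) G)
      + scalar (fls_X * fls_const (1/4)) *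
        (\<Sum>\<alpha>\<in>UNIV. \<Sum>\<beta>\<in>UNIV. Ac $ \<alpha> $ \<beta> * map_coeffs (ham l' \<alpha>) (map_coeffs (ham l' \<beta>) G))"
    by (rule fps_ext) (simp add: star_poly_a0 fps_sum_nth const_mat_def scalar_def sum_distrib_right mult.assoc)
  \<comment> \<open>The factor \<open>X ^ 2\<close> is shared out: one \<open>X\<close> belongs to
    each coordinate and one to each \<open>Y\<close>.\<close>
  moreover have "z \<beta> * Y \<alpha> G = fps_X ^ 2 * (fps_const (Var \<beta>) * map_coeffs (ham l' \<alpha>) G)" for \<alpha> \<beta>
    by (simp add: z_eq Y_def power2_eq_square mult_ac)
  moreover have "Y \<alpha> (Y \<beta> G) = fps_X ^ 2 * map_coeffs (ham l' \<alpha>) (map_coeffs (ham l' \<beta>) G)" for \<alpha> \<beta>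
  proof -
    have "map_coeffs (ham l' \<alpha>) (fps_X * F) = fps_X * map_coeffs (ham l' \<alpha>) F" for F
      using map_coeffs_X_power[OF derivation_ham, of l' \<alpha> 1] by simp
    then show ?thesis by (simp add: Y_def power2_eq_square mult.assoc)
  qed
  ultimately show ?thesis
    by (simp add: F0_eq sum_distrib_left sum_distrib_right distrib_left mult.assoc mult.left_commute[of _ "fps_X ^ 2"])
qed

section \<open>The closed formula and its derivatives along \<open>Y\<close>\<close>

definition H :: "'i graded^'i^'i" where "H = mat_series tan_series B"

definition T :: "'i graded^'i^'i" where "T = Lambda_inv_tan Lam Ac"

definition C :: "'i graded^'i^'i" where "C = mat_series cosh_series B"

definition g :: "'i graded" where "g = inv_sqrt (det C)"

definition e :: "'i graded" where "e = subst_series (fps_exp 1) (scalar (1 / fls_X) * quad_form T)"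

definition R :: "'i graded" where "R = g * e"

text \<open>The vector \<open>H Z\<close>, which is half of the derivative of
  \<open>quad_form T\<close> along \<open>Y\<close>.\<close>

definition w :: "'i \<Rightarrow> 'i graded" where "w \<alpha> = (\<Sum>\<beta>\<in>UNIV. H $ \<alpha> $ \<beta> * z \<beta>)"

lemma Lam_mult_T: "Lam ** T = H"
  unfolding T_def H_def by (rule Lambda_inv_tan) (rule Lam_nth_0)

lemma transpose_T: "transpose T = T"
  by (simp only: T_def Lambda_inv_tan_def transpose_Ac_mat_series tan_series_shift_even)

text \<open>The tangent is odd, so \<open>Ac ** H\<close> is skew. In
  \<open>transpose_H_mult_Lam\<close> the additional sign of \<open>Lam\<close> turns this into
  symmetry of \<open>H ** Lam\<close>.\<close>

lemma transpose_Ac_mult_H: "transpose (Ac ** H) = - (Ac ** H)"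
  by (simp add: H_def transpose_Ac_mat_series tan_series_odd mat_series_minus matrix_uminus_mult_right)

lemma transpose_H_mult_Ac: "transpose H ** Ac = - (Ac ** H)"
  using transpose_Ac_mult_H by (simp add: matrix_transpose_mul transpose_Ac)

lemma transpose_H_mult_Lam: "transpose (H ** Lam) = H ** Lam"
  by (simp add: H_def transpose_mat_series_Lam tan_series_odd mat_series_minus matrix_uminus_mult_left)

text \<open>From here on \<open>Y\<close> differentiates only the coordinates that occur
  explicitly.\<close>

lemma Y_mat_series: "Y \<alpha> (mat_series c B $ i $ j) = 0"
  by (rule mat_series_derivation_eq_0[OF derivation_Y causal_Y]) (simp_all add: Y_scalar Y_B B_nth_0)

lemma Y_T: "Y \<alpha> (T $ i $ j) = 0"
  by (simp add: T_def Lambda_inv_tan_def matrix_matrix_mult_def[of Ac] Y_rules Y_Ac Y_mat_series)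

text \<open>Each of the two coordinate factors contributes \<open>w \<alpha>\<close>, the second one
  through the symmetry of \<open>T\<close>.\<close>

lemma Y_quad_form_T: "Y \<alpha> (quad_form T) = 2 * w \<alpha>"
proof -
  have "Y \<alpha> (quad_form T) = (\<Sum>\<beta>\<in>UNIV. \<Sum>\<gamma>\<in>UNIV. Lam $ \<alpha> $ \<beta> * T $ \<beta> $ \<gamma> * z \<gamma>)
      + (\<Sum>\<beta>\<in>UNIV. \<Sum>\<gamma>\<in>UNIV. z \<beta> * T $ \<beta> $ \<gamma> * Lam $ \<alpha> $ \<gamma>)"
    by (simp add: quad_form_def Y_rules Y_z Y_T sum.distrib)
  also have "(\<Sum>\<beta>\<in>UNIV. \<Sum>\<gamma>\<in>UNIV. Lam $ \<alpha> $ \<beta> * T $ \<beta> $ \<gamma> * z \<gamma>) = w \<alpha>"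
    by (subst sum.swap) (simp add: w_def matrix_matrix_mult_def sum_distrib_right flip: Lam_mult_T)
  also have "(\<Sum>\<beta>\<in>UNIV. \<Sum>\<gamma>\<in>UNIV. z \<beta> * T $ \<beta> $ \<gamma> * Lam $ \<alpha> $ \<gamma>) = w \<alpha>"
  proof -
    have "T $ \<beta> $ \<gamma> = T $ \<gamma> $ \<beta>" for \<beta> \<gamma>
      using arg_cong[OF transpose_T, of "\<lambda>M. M $ \<gamma> $ \<beta>"] by (simp add: transpose_def)
    then have "z \<beta> * T $ \<beta> $ \<gamma> * Lam $ \<alpha> $ \<gamma> = Lam $ \<alpha> $ \<gamma> * T $ \<gamma> $ \<beta> * z \<beta>" for \<beta> \<gamma>
      by (simp add: mult_ac)
    then show ?thesis
      by (simp add: w_def matrix_matrix_mult_def sum_distrib_right flip: Lam_mult_T)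
  qed
  finally show ?thesis by simp
qed

text \<open>The derivative contracts \<open>H\<close> with the second index of \<open>Lam\<close>,
  that is, with the transpose of \<open>Lam\<close>; this produces the sign.\<close>

lemma Y_w: "Y \<alpha> (w \<beta>) = - (H ** Lam) $ \<alpha> $ \<beta>"
proof -
  have "Y \<alpha> (w \<beta>) = (\<Sum>\<gamma>\<in>UNIV. H $ \<beta> $ \<gamma> * Lam $ \<alpha> $ \<gamma>)"
    by (simp add: w_def H_def Y_rules Y_z Y_mat_series)
  also have "\<dots> = (H ** transpose Lam) $ \<beta> $ \<alpha>"
    by (simp add: matrix_matrix_mult_def transpose_def)
  also have "\<dots> = - (transpose (H ** Lam) $ \<alpha> $ \<beta>)"
    by (simp add: transpose_Lam matrix_uminus_mult_right) (simp add: transpose_def)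
  finally show ?thesis by (simp add: transpose_H_mult_Lam)
qed

lemma det_C_nth_0: "fps_nth (det C) 0 = 1"
proof -
  have "(\<chi> i j. fps_nth (C $ i $ j) 0) = mat 1"
    by (simp add: C_def mat_series_nth_0 cosh_series_def vec_eq_iff mat_def)
  then show ?thesis by (simp only: fps_nth_det_0 det_I)
qed

lemma quad_form_T_nth_0: "fps_nth (quad_form T) 0 = 0"
  by (simp add: quad_form_def fps_sum_nth z_nth_0)

lemma Y_g: "Y \<alpha> g = 0"
proof -
  \<comment> \<open>Jacobi's formula with \<open>N\<close> the zero matrix, since \<open>Y\<close>
    kills all entries of \<open>C\<close>.\<close>
  have "Y \<alpha> (det C) = trace (mat 0 :: 'i graded^'i^'i) * det C"
    by (rule derivation_det[OF derivation_Y]) (simp add: C_def Y_mat_series)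
  then show ?thesis
    unfolding g_def inv_sqrt_def
    by (subst derivation_subst_series[OF derivation_Y causal_Y])
       (simp_all add: Y_scalar det_C_nth_0 derivation_diff[OF derivation_Y] Y_rules trace_def)
qed

lemma Y_R: "Y \<alpha> R = 2 * scalar (1 / fls_X) * w \<alpha> * R"
proof -
  have "Y \<alpha> e = e * (scalar (1 / fls_X) * (2 * w \<alpha>))"
    unfolding e_def
    by (subst derivation_subst_series[OF derivation_Y causal_Y])
       (simp_all add: Y_scalar quad_form_T_nth_0 Y_rules Y_quad_form_T)
  then show ?thesis by (simp add: R_def Y_rules Y_g mult_ac)
qed

lemma Y_Y_R:
  "Y \<alpha> (Y \<beta> R) = (4 * scalar (1 / fls_X) ^ 2 * (w \<alpha> * w \<beta>) - 2 * scalar (1 / fls_X) * (H ** Lam) $ \<alpha> $ \<beta>) * R"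
proof -
  have "Y \<alpha> 2 = 0" using Y_scalar[of \<alpha> 2] by (simp add: scalar_numeral)
  then show ?thesis
    by (simp add: Y_R Y_rules Y_scalar Y_w algebra_simps power2_eq_square)
qed

text \<open>A quadratic form sees only the symmetric part of its matrix, and \<open>Ac ** H\<close>
  is skew.\<close>

lemma quad_form_Ac_mult_H: "quad_form (Ac ** H) = 0"
proof -
  have "quad_form (Ac ** H) = - quad_form (Ac ** H)"
    using quad_form_transpose[of "Ac ** H"] by (simp add: transpose_Ac_mult_H quad_form_uminus)
  then have "2 * quad_form (Ac ** H) = 0" by (simp add: eq_neg_iff_add_eq_0)
  \<comment> \<open>The factor 2 is cancelled by an explicit inverse among the scalars.\<close>
  moreover have "scalar (1/2) * (2 :: 'i graded) = 1"
  proof -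
    have "scalar (1/2 * 2) = scalar (1/2) * (2 :: 'i graded)"
      by (simp only: scalar_mult scalar_numeral)
    then show ?thesis by simp
  qed
  then have "quad_form (Ac ** H) = scalar (1/2) * (2 * quad_form (Ac ** H))"
    by (simp only: mult.assoc[symmetric] mult_1_left)
  ultimately show ?thesis by simp
qed

text \<open>The first order term vanishes by skewness of \<open>Ac ** H\<close>. The second order
  term splits into a square of \<open>w\<close>, which joins the exponent, and a trace, which
  belongs to the determinant factor. Doubling both sides avoids halves.\<close>

lemma star_R:
  "2 * star l F0 R = R * (2 * scalar (1 / fls_X) * (quad_form Ac - quad_form (Ac ** H ** H)) - trace (B ** H))"
proof -
  let ?s = "scalar (1 / fls_X)" and ?m = "scalar (fls_X * fls_const (1/4)) :: 'i graded"
  \<comment> \<open>The weight \<open>\<mu> / 4\<close> meets \<open>1 / \<mu>\<close> in both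
    second order contributions; this identity settles all constants.\<close>
  have ms: "4 * (?m * ?s) = 1"
  proof -
    have "fls_X * fls_const (1/4) * (1 / fls_X) = fls_const (1/4 :: complex)"
      by (simp only: times_divide_eq_right mult_1_right nonzero_mult_div_cancel_left[OF fls_X_nonzero])
    moreover have "4 * fls_const (1/4) = (1 :: complex fls)"
      using fls_const_mult_const[of "4 :: complex" "1/4"] by simp
    moreover have "scalar (4 * (fls_X * fls_const (1/4) * (1 / fls_X))) = 4 * (?m * ?s)"
      by (simp only: scalar_mult scalar_numeral)
    ultimately show ?thesis by (simp only: scalar_1)
  qed
  have first: "(\<Sum>\<alpha>\<in>UNIV. (\<Sum>\<beta>\<in>UNIV. Ac $ \<alpha> $ \<beta> * z \<beta>) * w \<alpha>) = 0"
    unfolding w_def sum_mult_vector_eq_quad_form by (simp add: transpose_Ac quad_form_Ac_mult_H)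
  \<comment> \<open>Symmetry of \<open>H ** Lam\<close> turns the double sum into a trace, which is
    then permuted cyclically.\<close>
  have tr: "(\<Sum>\<alpha>\<in>UNIV. \<Sum>\<beta>\<in>UNIV. Ac $ \<alpha> $ \<beta> * (H ** Lam) $ \<alpha> $ \<beta>) = trace (B ** H)"
  proof -
    have "(H ** Lam) $ \<alpha> $ \<beta> = (H ** Lam) $ \<beta> $ \<alpha>" for \<alpha> \<beta>
      using arg_cong[OF transpose_H_mult_Lam, of "\<lambda>M. M $ \<beta> $ \<alpha>"]
      by (simp only: transpose_def vec_lambda_beta)
    then have "(\<Sum>\<alpha>\<in>UNIV. \<Sum>\<beta>\<in>UNIV. Ac $ \<alpha> $ \<beta> * (H ** Lam) $ \<alpha> $ \<beta>) = trace (Ac ** (H ** Lam))"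
      by (simp only: trace_def matrix_matrix_mult_def[of Ac] vec_lambda_beta)
    also have "\<dots> = trace (Lam ** (Ac ** H))"
      by (simp only: matrix_mul_assoc trace_mul_sym[of _ Lam])
    finally show ?thesis by (simp only: matrix_mul_assoc)
  qed
  have second: "(\<Sum>\<alpha>\<in>UNIV. \<Sum>\<beta>\<in>UNIV. Ac $ \<alpha> $ \<beta> * (w \<alpha> * w \<beta>)) = - quad_form (Ac ** H ** H)"
  proof -
    have "(\<Sum>\<beta>\<in>UNIV. Ac $ \<alpha> $ \<beta> * w \<beta>) = (\<Sum>\<gamma>\<in>UNIV. (Ac ** H) $ \<alpha> $ \<gamma> * z \<gamma>)" for \<alpha>
      unfolding w_def sum_distrib_left matrix_matrix_mult_def
      by (subst sum.swap) (simp add: sum_distrib_right mult.assoc)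
    then have "(\<Sum>\<alpha>\<in>UNIV. w \<alpha> * (\<Sum>\<beta>\<in>UNIV. Ac $ \<alpha> $ \<beta> * w \<beta>)) = quad_form (transpose H ** (Ac ** H))"
      unfolding w_def sum_mult_vector_eq_quad_form[symmetric] by simp
    \<comment> \<open>Moving the transposed \<open>H\<close> past \<open>Ac\<close> changes the
      sign, which accounts for the minus in front of the square of \<open>H\<close>.\<close>
    also have "transpose H ** (Ac ** H) = - (Ac ** H ** H)"
      by (simp only: matrix_mul_assoc transpose_H_mult_Ac matrix_uminus_mult_left)
    finally show ?thesis
      by (simp add: quad_form_uminus sum_distrib_left mult.left_commute)
  qed
  have "(\<Sum>\<alpha>\<in>UNIV. (\<Sum>\<beta>\<in>UNIV. Ac $ \<alpha> $ \<beta> * z \<beta>) * Y \<alpha> R)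
      = (\<Sum>\<alpha>\<in>UNIV. (\<Sum>\<beta>\<in>UNIV. Ac $ \<alpha> $ \<beta> * z \<beta>) * w \<alpha>) * (2 * ?s * R)"
    by (simp add: Y_R sum_distrib_left mult_ac)
  moreover have "(\<Sum>\<alpha>\<in>UNIV. \<Sum>\<beta>\<in>UNIV. Ac $ \<alpha> $ \<beta> * Y \<alpha> (Y \<beta> R))
      = (4 * ?s ^ 2 * (\<Sum>\<alpha>\<in>UNIV. \<Sum>\<beta>\<in>UNIV. Ac $ \<alpha> $ \<beta> * (w \<alpha> * w \<beta>))
        - 2 * ?s * (\<Sum>\<alpha>\<in>UNIV. \<Sum>\<beta>\<in>UNIV. Ac $ \<alpha> $ \<beta> * (H ** Lam) $ \<alpha> $ \<beta>)) * R"
    by (simp add: Y_Y_R sum_distrib_left sum_distrib_right left_diff_distrib right_diff_distrib sum_subtractf mult_ac)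
  ultimately have "star l F0 R = ?s * quad_form Ac * R
      - ?m * (4 * ?s ^ 2 * quad_form (Ac ** H ** H) + 2 * ?s * trace (B ** H)) * R"
    by (subst star_F0) (simp only: first tr second F0_def, simp add: algebra_simps)
  also have "\<dots> = R * (?s * quad_form Ac - (4 * (?m * ?s)) * ?s * quad_form (Ac ** H ** H) - ?m * 2 * ?s * trace (B ** H))"
    by (simp add: algebra_simps power2_eq_square)
  finally have star_eq: "star l F0 R
      = R * (?s * quad_form Ac - (4 * (?m * ?s)) * ?s * quad_form (Ac ** H ** H) - ?m * 2 * ?s * trace (B ** H))" .
  have "2 * star l F0 R
      = R * (2 * ?s * quad_form Ac - (4 * (?m * ?s)) * (2 * ?s * quad_form (Ac ** H ** H)) - (4 * (?m * ?s)) * trace (B ** H))"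
    unfolding star_eq by (simp add: algebra_simps)
  then show ?thesis unfolding ms by (simp add: algebra_simps)
qed

section \<open>The Euler equation for \<open>R\<close>\<close>

lemma euler_Ac: "euler (Ac $ i $ j) = 0"
  by (simp add: const_mat_def euler_scalar)

text \<open>The two coordinates contribute one copy of the form each and the entries of
  \<open>T\<close> the rest. With \<open>t\<close> the shifted tangent these combine to
  \<open>2 t + 2 X t' = 2 (X t)'\<close>, twice the derivative of the tangent, to which its
  differential equation applies.\<close>

lemma euler_quad_form_T: "euler (quad_form T) = 2 * (quad_form Ac - quad_form (Ac ** H ** H))"
proof -
  let ?t = "fps_shift 1 tan_series"
  have euler_T: "euler (T $ i $ j) = (Ac ** mat_series (2 * fps_X * fps_deriv ?t) B) $ i $ j" for i j
    by (simp add: T_def Lambda_inv_tan_def matrix_matrix_mult_def[of Ac] euler_rules euler_mat_series[OF euler_B]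
        euler_Ac)
  have "euler (quad_form T) = quad_form T + quad_form T + quad_form (Ac ** mat_series (2 * fps_X * fps_deriv ?t) B)"
    by (simp add: quad_form_def euler_rules euler_z euler_T sum.distrib sum_distrib_left algebra_simps)
  also have "\<dots> = quad_form (Ac ** mat_series (?t + ?t + 2 * fps_X * fps_deriv ?t) B)"
    by (simp only: T_def Lambda_inv_tan_def mat_series_add matrix_add_ldistrib quad_form_add)
  also have "?t + ?t + 2 * fps_X * fps_deriv ?t = 2 * fps_deriv (fps_X * ?t)"
    by (simp add: algebra_simps)
  also have "\<dots> = 2 * fps_deriv tan_series"
    by (simp only: tan_series_shift)
  also have "\<dots> = (1 - tan_series * tan_series) + (1 - tan_series * tan_series)"
    by (simp only: fps_deriv_tan_series mult_2)
  also have "quad_form (Ac ** mat_series \<dots> B) = 2 * quad_form (Ac ** (mat 1 + - (H ** H)))"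
    by (simp only: mat_series_add matrix_add_ldistrib quad_form_add mat_series_minus mat_series_1
        mat_series_mult[OF B_nth_0] H_def mult_2 diff_conv_add_uminus)
  finally show ?thesis
    by (simp only: matrix_add_ldistrib matrix_uminus_mult_right quad_form_add quad_form_uminus
        matrix_mul_assoc matrix_mul_rid diff_conv_add_uminus)
qed

text \<open>Since \<open>2 X cosh' = (2 X tanh) cosh\<close>, Jacobi's formula applies to
  \<open>C\<close> and gives twice \<open>trace (B ** H)\<close>; the exponent \<open>-1/2\<close>
  halves this and changes its sign.\<close>

lemma euler_g: "euler g = - trace (B ** H) * g"
proof -
  let ?N = "mat_series (2 * fps_X * tan_series) B"
  have "euler (det C) = trace ?N * det C"
  proof (rule derivation_det[OF derivation_euler])
    show "euler (C $ i $ j) = (?N ** C) $ i $ j" for i j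
      by (simp add: C_def euler_mat_series[OF euler_B] mat_series_mult[OF B_nth_0] fps_deriv_cosh_series
          mult.assoc tan_series_mult_cosh_series)
  qed
  moreover have "trace ?N = 2 * trace (B ** H)"
  proof -
    have "B ** H = mat_series (fps_X * tan_series) B"
      using mat_series_mult[OF B_nth_0, of fps_X tan_series] by (simp only: H_def mat_series_X[OF B_nth_0])
    moreover have "2 * fps_X * tan_series = fps_X * tan_series + fps_X * tan_series"
      by simp
    ultimately show ?thesis by (simp only: mat_series_add trace_add mult_2)
  qed
  ultimately have euler_det: "euler (det C) = 2 * trace (B ** H) * det C" by simp
  have det0: "fps_nth (det C - 1) 0 = 0" by (simp add: det_C_nth_0)
  have "euler g = subst_series (fps_deriv (fps_binomial (- 1/2))) (det C - 1) * euler (det C - 1)"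
    unfolding g_def inv_sqrt_def
    by (rule derivation_subst_series[OF derivation_euler causal_euler euler_scalar det0])
  also have "euler (det C - 1) = 2 * trace (B ** H) * det C"
    by (simp add: derivation_diff[OF derivation_euler] euler_rules euler_det)
  \<comment> \<open>Writing \<open>det C\<close> as \<open>1 + (det C - 1)\<close> exposes the
    left-hand side of the binomial differential equation.\<close>
  also have "subst_series (fps_deriv (fps_binomial (- 1/2))) (det C - 1) * (2 * trace (B ** H) * det C)
      = (subst_series (fps_deriv (fps_binomial (- 1/2))) (det C - 1) * (1 + (det C - 1))) * (2 * trace (B ** H))"
    by (simp add: mult_ac)
  also have "subst_series (fps_deriv (fps_binomial (- 1/2))) (det C - 1) * (1 + (det C - 1)) = scalar (fls_const (- 1/2)) * g"
    unfolding g_def inv_sqrt_def subst_series_mult_1_plus_X[OF det0, symmetric] fps_deriv_fps_binomial_mult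
      subst_series_scale by simp
  also have "scalar (fls_const (- 1/2)) * g * (2 * trace (B ** H)) = (scalar (fls_const (- 1/2)) * 2) * (trace (B ** H) * g)"
    by (simp add: mult_ac)
  also have "scalar (fls_const (- 1/2)) * (2 :: 'i graded) = - 1"
  proof -
    have "fls_const (- 1/2) * 2 = (- 1 :: complex fls)"
      using fls_const_mult_const[of "- 1/2" "2 :: complex"] by simp
    then have "scalar (fls_const (- 1/2)) * (2 :: 'i graded) = scalar (- 1)"
      by (simp only: scalar_mult[symmetric] scalar_numeral[symmetric])
    then show ?thesis by (simp add: scalar_uminus)
  qed
  finally show ?thesis by simp
qed

text \<open>In the Leibniz rule \<open>g\<close> contributes the trace term of \<open>star_R\<close>
  and \<open>e\<close> the term with quadratic forms.\<close>

lemma euler_R: "euler R = 2 * star l F0 R"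
proof -
  have euler_e: "euler e = e * (scalar (1 / fls_X) * euler (quad_form T))"
    unfolding e_def
    by (subst derivation_subst_series[OF derivation_euler causal_euler])
       (simp_all add: euler_scalar quad_form_T_nth_0 euler_rules)
  have leibniz: "euler R = euler g * e + g * euler e"
    by (simp only: R_def euler_rules)
  show ?thesis
    unfolding leibniz star_R euler_e euler_g euler_quad_form_T
    unfolding R_def by (simp add: algebra_simps)
qed

section \<open>Recursion in the degree and the star exponential\<close>

lemma R_nth_0: "fps_nth R 0 = 1"
  by (simp add: R_def g_def e_def inv_sqrt_def subst_series_nth_0)

lemma ham_Const_mult: "ham l' \<alpha> (Const c * p) = Const c * ham l' \<alpha> p"
  by (simp add: derivation_mult[OF derivation_ham]) (simp add: ham_def dZ_Const)

lemma star_poly_a0_Const_mult: "star_poly l a0 (Const c * p) = Const c * star_poly l a0 p"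
  unfolding star_poly_a0 ham_Const_mult
  by (simp only: distrib_left sum_distrib_left sum_distrib_right mult_ac)

lemma star_poly_a0_0: "star_poly l a0 0 = 0"
  using star_poly_a0_Const_mult[of 0 0] by simp

lemma star_F0_nth: "fps_nth (star l F0 G) d = (if d < 2 then 0 else star_poly l a0 (fps_nth G (d - 2)))"
  by (simp add: star_F0_eq fps_X_power_mult_nth)

text \<open>The Euler equation in degree \<open>d\<close>, divided by \<open>d\<close>. Since
  \<open>F0\<close> raises the degree by two, it determines each component from the one two degrees
  lower.\<close>

lemma R_nth:
  assumes "d > 0"
  shows "fps_nth R d = (if d < 2 then 0 else Const (fls_const (2 / of_nat d)) * star_poly l a0 (fps_nth R (d - 2)))"
proof -
  have "of_nat d * fps_nth R d = fps_nth (2 * star l F0 R) d"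
    by (simp add: euler_nth flip: euler_R)
  also have "\<dots> = Const (fls_const 2) * fps_nth (star l F0 R) d"
  proof -
    have "Const (fls_const 2) = (2 :: ('i, complex fls) mpoly)"
      using Const_of_nat[of 2] by simp
    then show ?thesis by (simp only: mult_2 fps_add_nth)
  qed
  finally have "Const (fls_const (1 / of_nat d)) * (of_nat d * fps_nth R d)
      = Const (fls_const (1 / of_nat d)) * (Const (fls_const 2) * fps_nth (star l F0 R) d)" by simp
  moreover have "Const (fls_const (1 / of_nat d)) * of_nat d = (1 :: ('i, complex fls) mpoly)"
  proof -
    have "Const (fls_const (1 / of_nat d)) * Const (fls_const (of_nat d)) = (1 :: ('i, complex fls) mpoly)"
      using assms by (simp only: Const_mult[symmetric] fls_const_mult_const) simp
    then show ?thesis by (simp only: fls_const_of_nat Const_of_nat)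
  qed
  moreover have "Const (fls_const (1 / of_nat d)) * Const (fls_const 2) = (Const (fls_const (2 / of_nat d)) :: ('i, complex fls) mpoly)"
    by (simp only: Const_mult[symmetric] fls_const_mult_const times_divide_eq_left mult_1_left)
  ultimately have "fps_nth R d = Const (fls_const (2 / of_nat d)) * fps_nth (star l F0 R) d"
    by (simp only: mult.assoc[symmetric] mult_1_left)
  then show ?thesis by (simp only: star_F0_nth if_distrib[of "\<lambda>x. _ * x"] mult_zero_right)
qed

text \<open>The recursion moves in steps of two and starts from zero in degree one.\<close>

lemma R_nth_odd: "odd d \<Longrightarrow> fps_nth R d = 0"
proof (induction d rule: less_induct)
  case (less d)
  show ?case
  proof (cases "d < 2")
    case True
    then show ?thesis using less.prems by (subst R_nth) (auto intro: odd_pos)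
  next
    case False
    then have "fps_nth R (d - 2) = 0" using less by auto
    then show ?thesis using False by (subst R_nth) (auto simp: star_poly_a0_0)
  qed
qed

text \<open>The \<open>m\<close>-th star power lives in degree \<open>2 * m\<close> only. Both sides
  obey the same recursion with the same initial value 1, so each degree of \<open>R\<close> is
  exactly one term of the exponential series.\<close>

lemma star_power_nth:
  "Const (fls_const (1 / fact m)) * fps_nth (star_power l F0 m) d = (if d = 2 * m then fps_nth R d else 0)"
proof (induction m arbitrary: d)
  case 0
  then show ?case by (simp add: R_nth_0)
next
  case (Suc m)
  \<comment> \<open>In degree \<open>2 * Suc m\<close> the recursion factor \<open>2 / d\<close> is
    \<open>1 / Suc m\<close>, the step between consecutive inverse factorials.\<close>
  have "2 / (2 * x) * (1 / y) = 1 / (x * y)" for x y :: complex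
    by simp
  from this[of "of_nat (Suc m)" "fact m"]
  have "fls_const (1 / fact (Suc m)) = fls_const (2 / of_nat (2 * Suc m)) * fls_const (1 / fact m :: complex)"
    by (simp only: fls_const_mult_const fact_Suc of_nat_mult of_nat_numeral)
  then have *: "Const (fls_const (1 / fact (Suc m))) * star_poly l a0 p
      = Const (fls_const (2 / of_nat (2 * Suc m))) * star_poly l a0 (Const (fls_const (1 / fact m)) * p)" for p
    by (simp only: star_poly_a0_Const_mult Const_mult mult.assoc)
  show ?case
  proof (cases "d < 2")
    case True
    then show ?thesis by (simp add: star_F0_nth)
  next
    case False
    then have iff: "d - 2 = 2 * m \<longleftrightarrow> d = 2 * Suc m" by auto
    have R_d: "fps_nth R d = Const (fls_const (2 / of_nat d)) * star_poly l a0 (fps_nth R (d - 2))"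
      using R_nth[of d] False by simp
    note step = star_power.simps star_F0_nth if_not_P[OF False] * Suc.IH iff
    show ?thesis
    proof (cases "d = 2 * Suc m")
      case True
      show ?thesis unfolding step if_P[OF True] R_d by (simp only: True)
    next
      case ne: False
      show ?thesis unfolding step if_not_P[OF ne] by (simp only: star_poly_a0_0 mult_zero_right)
    qed
  qed
qed

lemma star_exp_F0: "star_exp l F0 = R"
proof (rule fps_ext)
  fix d
  have "fps_nth (star_exp l F0) d = Sum_any (\<lambda>m. if d = 2 * m then fps_nth R d else 0)"
    by (simp add: star_exp_def star_power_nth)
  \<comment> \<open>For odd \<open>d\<close> the condition fails at \<open>d div 2\<close> too, so
    the sum is zero, in agreement with \<open>R_nth_odd\<close>.\<close>
  also have "\<dots> = (\<Sum>m\<in>{d div 2}. if d = 2 * m then fps_nth R d else 0)"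
    by (rule Sum_any.expand_superset) (auto split: if_splits)
  also have "\<dots> = fps_nth R d"
    using R_nth_odd[of d] by (cases "even d") auto
  finally show "fps_nth (star_exp l F0) d = fps_nth R d" .
qed

lemma R_formal_sections: "R \<in> formal_sections"
proof -
  have Ac: "Ac $ i $ j \<in> formal_sections" for i j
    by (simp add: const_mat_def formal_sections_scalar)
  have B: "B $ i $ j \<in> formal_sections" for i j
    by (intro formal_sections_matrix_mult Ac) (simp add: Lambda_mat_def formal_sections_to_graded)
  have "det C + (- 1) \<in> formal_sections"
    unfolding C_def by (intro formal_sections_add formal_sections_uminus formal_sections_1 formal_sections_det
        formal_sections_mat_series B)
  moreover have "T $ i $ j \<in> formal_sections" for i j
    unfolding T_def Lambda_inv_tan_def by (intro formal_sections_matrix_mult Ac formal_sections_mat_series B)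
  ultimately show ?thesis
    unfolding R_def g_def e_def inv_sqrt_def
    by (intro formal_sections_mult formal_sections_subst_series formal_sections_scalar formal_sections_quad_form)
       simp_all
qed

text \<open>The exponential of \<open>- B\<close> is the reflected exponential series in
  \<open>B\<close>, so the average is the series of the hyperbolic cosine.\<close>

lemma C_eq:
  "(\<chi> \<alpha> \<beta>. scalar (fls_const (1/2)) * (mat_exp B + mat_exp (- B)) $ \<alpha> $ \<beta>) = C"
proof -
  have "mat_exp B + mat_exp (- B) = mat_series (fps_exp 1 + fps_exp (- 1)) B"
    by (simp add: mat_exp_def mat_series_uminus fps_exp_compose_uminus mat_series_add)
  then show ?thesis
    unfolding C_def cosh_series_def by (simp only: vec_eq_iff vec_lambda_beta mat_series_scale) blast
qed

end

theorem theorem1p3: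
  fixes \<Lambda> :: "('i::finite, complex) mpoly^'i^'i"
    and A :: "complex^'i^'i"
  assumes skew: "\<forall>\<alpha> \<beta>. \<Lambda> $ \<alpha> $ \<beta> = - (\<Lambda> $ \<beta> $ \<alpha>)"
    and order_zero: "\<forall>\<alpha> \<beta>. \<Lambda> $ \<alpha> $ \<beta> \<in> H0 2"
    and jacobi: "\<forall>f g h. bracket \<Lambda> f (bracket \<Lambda> g h) + bracket \<Lambda> g (bracket \<Lambda> h f)
                          + bracket \<Lambda> h (bracket \<Lambda> f g) = 0"
    and arrows: "\<forall>k\<ge>1. \<forall>f g. arrow_product \<Lambda> k f g = bidiff \<Lambda> k f g"
    and A_sym: "transpose A = A"
  shows "let \<Lambda>A = Lambda_mat \<Lambda> ** const_mat A;
             C = (\<chi> \<alpha> \<beta>. scalar (fls_const (1/2)) * (mat_exp \<Lambda>A + mat_exp (- \<Lambda>A)) $ \<alpha> $ \<beta>);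
             T = Lambda_inv_tan (Lambda_mat \<Lambda>) (const_mat A);
             R = inv_sqrt (det C) * subst_series (fps_exp 1) (scalar (1 / fls_X) * quad_form T)
         in star_exp \<Lambda> (scalar (1 / fls_X) * quad_form (const_mat A)) = R
            \<and> R \<in> formal_sections"
proof -
  interpret casimir_star \<Lambda> A
  proof
    show "\<Lambda> $ \<alpha> $ \<beta> = - (\<Lambda> $ \<beta> $ \<alpha>)" for \<alpha> \<beta> using skew by blast
    show "\<Lambda> $ \<alpha> $ \<beta> \<in> H0 2" for \<alpha> \<beta> using order_zero by blast
    show "ham \<Lambda> \<alpha> (\<Lambda> $ \<beta> $ \<gamma>) = 0" for \<alpha> \<beta> \<gamma>
    proof (rule ham_entry_eq_0)
      show "arrow_product \<Lambda> 2 f g = bidiff \<Lambda> 2 f g" for f g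
        using arrows by simp
    qed (use skew jacobi in blast)+
  qed (rule A_sym)
  have "R = inv_sqrt (det C) * subst_series (fps_exp 1) (scalar (1 / fls_X) * quad_form T)"
    by (simp add: R_def g_def e_def)
  then show ?thesis
    unfolding Let_def C_eq T_def[symmetric] F0_def[symmetric]
    using star_exp_F0 R_formal_sections by simp
qed

end
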